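(* Let $r\in\{4,5,6\}$. Then $\mathrm{ex}_r(N,\mathcal{C}_{<5}) \geq N^{3/2-o(1)}$ as $N\to\infty$; that is, $\mathrm{ex}_r(N, \mathcal{C}_{<5}) = \Omega_r\left(N^{3/2-o(1)}\right)$.
   Context: An $r$-uniform hypergraph on a finite vertex set $X$ is a collection of $r$-element subsets (edges) of $X$. A Berge cycle of length $k\ge 2$ in a hypergraph is a sequence of $k$ distinct vertices $v_1,\dots,v_k$ and $k$ distinct edges $E_1,\dots,E_k$ such that $\{v_i,v_{i+1}\}\subseteq E_i$ for all $i$, indices read modulo $k$. $\mathcal{C}_{<g}$ denotes the family of Berge cycles of lengths $2,3,\dots,g-1$; a hypergraph is $\mathcal{C}_{<g}$-free (has girth at least $g$) if it contains no Berge cycle of length $k$ for any $2\le k\le g-1$. $\mathrm{ex}_r(N,\mathcal{C}_{<g})$ denotes the maximum number of edges in an $N$-vertex $r$-uniform $\mathcal{C}_{<g}$-free hypergraph. *)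

theory Defs
  imports Complex_Main
begin

definition uniform_hypergraph :: "nat \<Rightarrow> 'a set \<Rightarrow> 'a set set \<Rightarrow> bool" where
  "uniform_hypergraph r X H \<longleftrightarrow> finite X \<and> (\<forall>E\<in>H. E \<subseteq> X \<and> card E = r)"

text \<open>Only the values of \<open>v\<close> and \<open>e\<close> at the indices \<open>0, \<dots>, k - 1\<close> matter.\<close>

definition berge_cycle :: "'a set set \<Rightarrow> nat \<Rightarrow> (nat \<Rightarrow> 'a) \<Rightarrow> (nat \<Rightarrow> 'a set) \<Rightarrow> bool" where
  "berge_cycle H k v e \<longleftrightarrow>
     2 \<le> k \<and> inj_on v {..<k} \<and> inj_on e {..<k} \<and>
     (\<forall>i<k. e i \<in> H \<and> {v i, v (Suc i mod k)} \<subseteq> e i)"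

definition berge_cycle_free :: "nat \<Rightarrow> 'a set set \<Rightarrow> bool" where
  "berge_cycle_free g H \<longleftrightarrow> (\<forall>k. 2 \<le> k \<and> k < g \<longrightarrow> (\<nexists>v e. berge_cycle H k v e))"

text \<open>
  \<open>ex_girth r N g\<close> is $\mathrm{ex}_r(N, \mathcal{C}_{<g})$. Being invariant under isomorphism, it is
  computed on the fixed vertex set \<open>{..<N}\<close>.
\<close>

definition ex_girth :: "nat \<Rightarrow> nat \<Rightarrow> nat \<Rightarrow> nat" where
  "ex_girth r N g =
     Max {card H |H. uniform_hypergraph r {..<N} H \<and> berge_cycle_free g H}"

lemma ex_girth_set_finite_nonempty:
  fixes r N g :: nat
  defines "S \<equiv> {card H |H. uniform_hypergraph r {..<N} H \<and> berge_cycle_free g H}"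
  shows "finite S" and "S \<noteq> {}"
proof -
  have "S \<subseteq> card ` Pow (Pow {..<N})"
    unfolding S_def uniform_hypergraph_def by auto
  then show "finite S" by (rule finite_subset) simp
  have "uniform_hypergraph r {..<N} {}"
    by (simp add: uniform_hypergraph_def)
  moreover have "\<not> berge_cycle {} k v e" for k :: nat and v :: "nat \<Rightarrow> nat" and e
    unfolding berge_cycle_def by (auto intro: exI[of _ 0])
  then have "berge_cycle_free g ({} :: nat set set)"
    by (simp add: berge_cycle_free_def)
  ultimately show "S \<noteq> {}" unfolding S_def by blast
qed

end

theory Submission
  imports Defs "HOL-Number_Theory.Number_Theory"
begin

text \<open>
  Let \<open>p \<equiv> 3\<close> modulo \<open>4\<close> be a prime modulo which \<open>17\<close> is a square, and let \<open>B \<subseteq> \<int>/p\<close>.  Take as edges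
  the sets \<open>{(i, x + c\<^sub>i a, y + c\<^sub>i a\<^sup>2) | i < r}\<close> with \<open>x, y \<in> \<int>/p\<close> and \<open>a \<in> B\<close>.  A Berge cycle of length
  at most \<open>4\<close> whose vertices lie in the parts \<open>i\<^sub>0, i\<^sub>1, \<dots>\<close> and whose edges have directions
  \<open>a\<^sub>0, a\<^sub>1, \<dots>\<close> yields \<open>\<Sum> \<alpha>\<^sub>t a\<^sub>t = \<Sum> \<alpha>\<^sub>t a\<^sub>t\<^sup>2 = 0\<close>, where the \<open>\<alpha>\<^sub>t\<close> are the differences of consecutive slopes
  \<open>c\<close>.  For four terms, the solutions up to translation form a binary quadratic equation with
  discriminant \<open>\<Prod> \<alpha>\<^sub>t\<close>.  The slopes are chosen such that this product is always \<open>\<plusminus>m\<^sup>2\<close> or \<open>\<plusminus>17m\<^sup>2\<close>.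
  If it is negative, it is a non-residue modulo \<open>p\<close> and only trivial solutions exist; if it is positive, every
  solution satisfies a three-term linear relation with bounded coefficients in \<open>\<int>[\<surd>17]\<close>.  Behrend's
  sphere construction, with digits in \<open>\<int>[\<surd>17]\<close>, provides a set \<open>B\<close> of size \<open>p\<^sup>1\<^sup>-\<^sup>o\<^sup>(\<^sup>1\<^sup>)\<close> without such relations.
  Mertens' argument for the quadratic characters modulo \<open>4\<close>, \<open>17\<close> and \<open>68\<close> shows that suitable primes
  exist in every interval \<open>(y, Ky]\<close>.
\<close>

section \<open>Primes in short multiplicative intervals\<close>

text \<open>Expand \<open>ln n\<close> as the sum of \<open>mangoldt d\<close> over
  \<open>d dvd n\<close> and exchange the summations. Applied to the constant 1 it gives Mertens'
  estimate, applied to \<open>\<chi> n / n\<close> it links \<open>L(1, \<chi>)\<close> to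
  primes.\<close>

lemma sum_mult_ln_eq_mangoldt:
  fixes f :: "nat \<Rightarrow> real"
  shows "(\<Sum>n=1..N. f n * ln n) = (\<Sum>d=1..N. mangoldt d * (\<Sum>m=1..N div d. f (d * m)))"
proof -
  have "(\<Sum>n=1..N. f n * ln n) = (\<Sum>n=1..N. \<Sum>d | d dvd n. mangoldt d * f n)"
  proof (rule sum.cong[OF refl])
    fix n assume "n \<in> {1..N}"
    then have "ln (real n) = (\<Sum>d | d dvd n. mangoldt d)" by (simp add: mangoldt_sum)
    then show "f n * ln n = (\<Sum>d | d dvd n. mangoldt d * f n)"
      by (simp add: sum_distrib_left mult.commute)
  qed
  also have "\<dots> = (\<Sum>(n,d)\<in>(SIGMA n:{1..N}. {d. d dvd n}). mangoldt d * f n)"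
    by (subst sum.Sigma) (auto intro: dvd_imp_le)
  also have "\<dots> = (\<Sum>(d,m)\<in>(SIGMA d:{1..N}. {1..N div d}). mangoldt d * f (d * m))"
  proof (rule sum.reindex_bij_witness[of _ "\<lambda>(d,m). (d * m, d)" "\<lambda>(n,d). (d, n div d)"])
    fix a assume "a \<in> (SIGMA n:{1..N}. {d. d dvd n})"
    then obtain d m where a: "a = (d * m, d)" "1 \<le> d * m" "d * m \<le> N" by (auto elim!: dvdE)
    then have "d \<ge> 1" "m \<ge> 1" by (auto simp: Suc_le_eq)
    moreover have "m \<le> N div d" using a \<open>d \<ge> 1\<close> by (simp add: less_eq_div_iff_mult_less_eq mult.commute)
    moreover have "d \<le> N" using a \<open>m \<ge> 1\<close> by (metis le_trans mult.right_neutral mult_le_mono2)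
    ultimately show "(case a of (n, d) \<Rightarrow> (d, n div d)) \<in> (SIGMA d:{1..N}. {1..N div d})"
      "(case case a of (n, d) \<Rightarrow> (d, n div d) of (d, m) \<Rightarrow> (d * m, d)) = a"
      "(case case a of (n, d) \<Rightarrow> (d, n div d) of (d, m) \<Rightarrow> mangoldt d * f (d * m)) =
        (case a of (n, d) \<Rightarrow> mangoldt d * f n)"
      using a by auto
  next
    fix b assume "b \<in> (SIGMA d:{1..N}. {1..N div d})"
    then obtain d m where b: "b = (d, m)" "1 \<le> d" "d \<le> N" "1 \<le> m" "m \<le> N div d" by auto
    then have "d * m \<le> N" by (simp add: less_eq_div_iff_mult_less_eq mult.commute)
    then show "(case b of (d, m) \<Rightarrow> (d * m, d)) \<in> (SIGMA n:{1..N}. {d. d dvd n})"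
      "(case case b of (d, m) \<Rightarrow> (d * m, d) of (n, d) \<Rightarrow> (d, n div d)) = b"
      using b by auto
  qed
  also have "\<dots> = (\<Sum>d=1..N. mangoldt d * (\<Sum>m=1..N div d. f (d * m)))"
    by (subst sum.Sigma[symmetric]) (auto simp: sum_distrib_left)
  finally show ?thesis .
qed

lemma sum_ln_eq_mangoldt: "(\<Sum>n=1..N. ln (real n)) = (\<Sum>d=1..N. mangoldt d * real (N div d))"
  using sum_mult_ln_eq_mangoldt[of "\<lambda>_. 1" N] by simp

lemma ln_fact_eq_sum: "ln (fact n) = (\<Sum>k=1..n. ln (real k))"
  by (induction n) (simp_all add: ln_mult)

text \<open>Chebyshev's argument: \<open>ln (2 * n choose n)\<close> is the sum of
  \<open>mangoldt d\<close> with weights \<open>2*n div d - 2 * (n div d)\<close>. These are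
  nonnegative, and at least 1 for \<open>n < d \<le> 2*n\<close>, while the binomial coefficient is
  at most \<open>4 ^ n\<close>.\<close>

lemma mangoldt_sum_double_le:
  "(\<Sum>d=1..2*n. mangoldt d :: real) \<le> (\<Sum>d=1..n. mangoldt d) + 2 * n * ln 2"
proof -
  have "(\<Sum>d=n+1..2*n. mangoldt d :: real)
     \<le> (\<Sum>d=1..2*n. mangoldt d * (real (2*n div d) - 2 * real (n div d)))"
  proof -
    have nn: "0 \<le> real (2*n div d) - 2 * real (n div d)" for d
    proof -
      have "2 * (n div d) \<le> 2 * n div d"
        by (metis div_mult2_eq div_times_less_eq_dividend less_eq_div_iff_mult_less_eq mult.commute mult.left_commute mult_le_mono2 div_by_0 le0 mult_0_right bot_nat_0.not_eq_extremum)
      then show ?thesis by linarith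
    qed
    have "(\<Sum>d=n+1..2*n. mangoldt d :: real)
       \<le> (\<Sum>d=n+1..2*n. mangoldt d * (real (2*n div d) - 2 * real (n div d)))"
    proof (rule sum_mono)
      fix d assume d: "d \<in> {n+1..2*n}"
      then have "n div d = 0" "2*n div d \<ge> 1" by (auto simp: less_eq_div_iff_mult_less_eq)
      then have "1 \<le> real (2*n div d) - 2 * real (n div d)" by simp
      then show "mangoldt d \<le> mangoldt d * (real (2*n div d) - 2 * real (n div d))"
        using mult_left_mono[OF _ mangoldt_nonneg[of d]] by fastforce
    qed
    also have "\<dots> \<le> (\<Sum>d=1..2*n. mangoldt d * (real (2*n div d) - 2 * real (n div d)))"
      by (rule sum_mono2) (auto intro!: mult_nonneg_nonneg mangoldt_nonneg nn[simplified])
    finally show ?thesis .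
  qed
  also have "\<dots> = (\<Sum>d=1..2*n. mangoldt d * real (2*n div d)) - 2 * (\<Sum>d=1..2*n. mangoldt d * real (n div d))"
    by (simp add: right_diff_distrib sum_subtractf sum_distrib_left mult.left_commute)
  also have "(\<Sum>d=1..2*n. mangoldt d * real (n div d)) = (\<Sum>d=1..n. mangoldt d * real (n div d))"
    by (rule sum.mono_neutral_right) auto
  also have "(\<Sum>d=1..2*n. mangoldt d * real (2*n div d)) - 2 * \<dots> = ln (fact (2*n)) - 2 * ln (fact n)"
    by (simp only: sum_ln_eq_mangoldt ln_fact_eq_sum)
  also have "\<dots> = ln (real (2 * n choose n))"
  proof -
    have "real (2 * n choose n) = fact (2*n) / (fact n * fact n)"
      using binomial_fact[of n "2*n", where 'a=real] by simp
    then show ?thesis by (simp add: ln_div ln_mult)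
  qed
  also have "\<dots> \<le> ln (2 ^ (2*n))"
  proof -
    have "2 * n choose n \<le> 2 ^ (2*n)" by (rule binomial_le_pow2)
    then have "real (2 * n choose n) \<le> 2 ^ (2*n)" by (metis of_nat_le_iff of_nat_numeral of_nat_power)
    then show ?thesis by (subst ln_le_cancel_iff) auto
  qed
  also have "\<dots> = 2 * n * ln 2" by (simp add: ln_realpow)
  finally have "(\<Sum>d=n+1..2*n. mangoldt d :: real) \<le> 2 * n * ln 2" .
  moreover have "(\<Sum>d=1..2*n. mangoldt d :: real) = (\<Sum>d=1..n. mangoldt d) + (\<Sum>d=n+1..2*n. mangoldt d)"
    using sum.ub_add_nat[of 1 n "mangoldt :: nat \<Rightarrow> real" n] by (simp add: mult_2)
  ultimately show ?thesis by linarith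
qed

text \<open>Halving \<open>n\<close> gives \<open>4 * m + 2 * m\<close> at \<open>2 * m\<close>. The
  spare \<open>2 * m\<close> pays for the single term \<open>ln n \<le> n - 1\<close> when
  \<open>n\<close> is odd.\<close>

lemma chebyshev_psi_le: "(\<Sum>d=1..n. mangoldt d :: real) \<le> 4 * n"
proof (induction n rule: less_induct)
  case (less n)
  have ln2: "ln 2 \<le> (1::real)" using ln_le_minus_one[of "2::real"] by simp
  show ?case
  proof (cases "n = 0")
    case False
    define m where "m = n div 2"
    then have m: "m < n" using False by simp
    have *: "(\<Sum>d=1..2*m. mangoldt d :: real) \<le> 4 * m + 2 * m"
      using mangoldt_sum_double_le[of m] less[OF m] mult_left_mono[OF ln2, of "2 * m"] by simp
    consider "n = 2 * m" | "n = Suc (2 * m)" unfolding m_def by linarith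
    then show ?thesis
    proof cases
      case 1 then show ?thesis using * by simp
    next
      case 2
      have "mangoldt n \<le> ln (real n)" using False by (intro mangoldt_le) simp
      also have "\<dots> \<le> real n - 1" using False by (intro ln_le_minus_one) simp
      finally show ?thesis using * 2 by simp
    qed
  qed simp
qed

lemma sum_ln_ge: "(\<Sum>n=1..N. ln (real n)) \<ge> N * ln N - N"
proof (induction N)
  case (Suc N)
  show ?case
  proof (cases "N = 0")
    case False
    have "ln (real (Suc N)) - ln N \<le> 1 / N"
      using ln_diff_le[of "Suc N" N] False by simp
    then have "N * ln (Suc N) - N * ln N \<le> 1"
      using False mult_left_mono[of "ln (real (Suc N)) - ln N" "1/N" N] by (simp add: right_diff_distrib)
    then show ?thesis using Suc by (simp add: algebra_simps)
  qed simp
qed simp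

text \<open>The sum of \<open>ln n\<close> is at least \<open>N * ln N - N\<close>, and as a divisor
  sum it only grows when the floor in \<open>N div d\<close> is dropped.\<close>

lemma mertens_lower:
  assumes "N > 0"
  shows "(\<Sum>d=1..N. mangoldt d / real d) \<ge> ln N - 1"
proof -
  have "N * ln N - N \<le> (\<Sum>d=1..N. mangoldt d * real (N div d))"
    using sum_ln_ge[of N] by (simp only: sum_ln_eq_mangoldt)
  also have "\<dots> \<le> (\<Sum>d=1..N. N * (mangoldt d / real d))"
  proof (rule sum_mono)
    fix d
    show "mangoldt d * real (N div d) \<le> N * (mangoldt d / real d)"
      using mult_left_mono[OF of_nat_div_le_of_nat[of N d] mangoldt_nonneg[of d]] by (simp add: mult.commute)
  qed
  finally have "N * (ln N - 1) \<le> N * (\<Sum>d=1..N. mangoldt d / real d)"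
    by (simp add: sum_distrib_left algebra_simps)
  then show ?thesis using assms by simp
qed

text \<open>Each floor in \<open>N div d\<close> loses at most 1, so the total loss is at most the
  Chebyshev sum, which is \<open>4 * N\<close>.\<close>

lemma mertens_upper:
  assumes "N > 0"
  shows "(\<Sum>d=1..N. mangoldt d / real d) \<le> ln N + 4"
proof -
  have "(\<Sum>d=1..N. N * (mangoldt d / real d)) - (\<Sum>d=1..N. mangoldt d)
      \<le> (\<Sum>d=1..N. mangoldt d * real (N div d))"
    unfolding sum_subtractf[symmetric]
  proof (rule sum_mono)
    fix d assume "d \<in> {1..N}"
    have "real N / real d - 1 \<le> real (N div d)"
      using floor_divide_of_nat_eq[of N d, where 'a=real] by linarith
    then show "N * (mangoldt d / real d) - mangoldt d \<le> mangoldt d * real (N div d)"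
      using mult_left_mono[OF _ mangoldt_nonneg, of "real N / real d - 1" "real (N div d)" d]
      by (simp add: algebra_simps)
  qed
  also have "\<dots> = (\<Sum>n=1..N. ln (real n))" by (simp only: sum_ln_eq_mangoldt)
  also have "\<dots> \<le> (\<Sum>n=1..N. ln (real N))" by (rule sum_mono) auto
  finally have "N * (\<Sum>d=1..N. mangoldt d / real d) \<le> N * ln N + 4 * N"
    using chebyshev_psi_le[of N] by (simp add: sum_distrib_left)
  then have "N * (\<Sum>d=1..N. mangoldt d / real d) \<le> N * (ln N + 4)" by (simp add: algebra_simps)
  then show ?thesis using assms by simp
qed

lemma sum_split_at:
  fixes f :: "nat \<Rightarrow> 'a::comm_monoid_add"
  assumes "a \<le> b"
  shows "(\<Sum>n=1..b. f n) = (\<Sum>n=1..a. f n) + (\<Sum>n=Suc a..b. f n)"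
  using sum.ub_add_nat[of 1 a f "b - a"] assms by simp

section \<open>Mertens' argument for a character with bounded partial sums\<close>

text \<open>Abstracts a nonprincipal real Dirichlet character: the cancellation over a period
  appears only as the bound \<open>B\<close>.\<close>

locale bounded_character =
  fixes \<chi> :: "nat \<Rightarrow> real" and B :: real
  assumes mult: "\<chi> (m * n) = \<chi> m * \<chi> n"
    and abs_le_1: "\<bar>\<chi> n\<bar> \<le> 1"
    and partial_sum_le: "\<bar>\<Sum>k=1..n. \<chi> k\<bar> \<le> B"
begin

lemma B_nonneg: "B \<ge> 0"
  using partial_sum_le[of 0] by simp

lemma interval_sum_le: "\<bar>\<Sum>k=Suc a..b. \<chi> k\<bar> \<le> 2 * B"
proof (cases "a \<le> b")
  case True
  then have "(\<Sum>k=1..b. \<chi> k) = (\<Sum>k=1..a. \<chi> k) + (\<Sum>k=Suc a..b. \<chi> k)"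
    by (rule sum_split_at)
  then show ?thesis using partial_sum_le[of a] partial_sum_le[of b] by linarith
qed (use B_nonneg in simp)

lemma abel_bound:
  assumes anti: "\<And>n. n > a \<Longrightarrow> f (Suc n) \<le> f n" and nonneg: "\<And>n. n > a \<Longrightarrow> f n \<ge> (0::real)"
  shows "\<bar>\<Sum>n=Suc a..b. \<chi> n * f n\<bar> \<le> 2 * B * f (Suc a)"
proof (cases "a < b")
  case True
  then have "Suc a \<le> b" by simp
  \<comment> \<open>Summation by parts. With the boundary term split off, one more term adds only
    the interval sum times \<open>f b - f (Suc b)\<close>, so the bounds telescope.\<close>
  then have "\<bar>(\<Sum>n=Suc a..b. \<chi> n * f n) - (\<Sum>n=Suc a..b. \<chi> n) * f b\<bar> \<le> 2 * B * (f (Suc a) - f b)"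
  proof (induction b rule: dec_induct)
    case (step b)
    let ?T = "\<Sum>n=Suc a..b. \<chi> n"
    have "\<bar>?T * (f b - f (Suc b))\<bar> \<le> 2 * B * (f b - f (Suc b))"
      unfolding abs_mult using anti[of b] step.hyps interval_sum_le[of a b]
      by (intro mult_mono) auto
    moreover have "(\<Sum>n=Suc a..Suc b. \<chi> n * f n) - (\<Sum>n=Suc a..Suc b. \<chi> n) * f (Suc b)
       = ((\<Sum>n=Suc a..b. \<chi> n * f n) - ?T * f b) + ?T * (f b - f (Suc b))"
      using step.hyps by (simp add: algebra_simps)
    ultimately show ?case using step.IH unfolding right_diff_distrib by linarith
  qed simp
  moreover have "\<bar>(\<Sum>n=Suc a..b. \<chi> n) * f b\<bar> \<le> 2 * B * f b"
    unfolding abs_mult using nonneg[OF True] interval_sum_le[of a b] by (intro mult_mono) auto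
  ultimately show ?thesis unfolding right_diff_distrib by linarith
qed (use nonneg[of "Suc a"] B_nonneg in simp)

definition S :: "nat \<Rightarrow> real" where "S n = (\<Sum>m=1..n. \<chi> m / m)"

text \<open>The value \<open>L(1, \<chi>)\<close> of the Dirichlet series.\<close>

definition L :: real where "L = lim S"

lemma S_diff_le:
  assumes "a \<le> b"
  shows "\<bar>S b - S a\<bar> \<le> 2 * B / (a + 1)"
proof -
  have "S b = S a + (\<Sum>m=Suc a..b. \<chi> m / m)"
    unfolding S_def by (rule sum_split_at[OF assms])
  moreover have "\<bar>\<Sum>m=Suc a..b. \<chi> m * (1 / real m)\<bar> \<le> 2 * B * (1 / real (Suc a))"
    by (rule abel_bound) (auto simp: field_simps)
  ultimately show ?thesis by (simp add: add.commute)
qed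

lemma S_tendsto: "S \<longlonglongrightarrow> L"
proof -
  have "Cauchy S"
  proof (rule CauchyI)
    fix e :: real assume "e > 0"
    obtain M :: nat where M: "4 * B / e < M" using reals_Archimedean2 by blast
    have *: "\<bar>S n - S M\<bar> < e / 2" if "M \<le> n" for n
    proof -
      have "\<bar>S n - S M\<bar> \<le> 2 * B / (M + 1)" using S_diff_le[OF that] .
      also have "\<dots> < e / 2"
      proof -
        have "4 * B < e * M" using M \<open>e > 0\<close> by (simp add: field_simps)
        also have "\<dots> \<le> e * (M + 1)" using \<open>e > 0\<close> by (intro mult_left_mono) auto
        finally show ?thesis by (simp add: field_simps)
      qed
      finally show ?thesis .
    qed
    have "norm (S m - S n) < e" if "M \<le> m" "M \<le> n" for m n
      using *[of m] *[of n] that unfolding real_norm_def by linarith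
    then show "\<exists>M. \<forall>m\<ge>M. \<forall>n\<ge>M. norm (S m - S n) < e" by blast
  qed
  then show ?thesis unfolding L_def by (simp add: Cauchy_convergent_iff convergent_LIMSEQ_iff)
qed

lemma L_S_le: "\<bar>L - S a\<bar> \<le> 2 * B / (a + 1)"
proof (rule tendsto_upperbound)
  show "(\<lambda>n. \<bar>S n - S a\<bar>) \<longlonglongrightarrow> \<bar>L - S a\<bar>" by (intro tendsto_intros S_tendsto)
  show "\<forall>\<^sub>F n in sequentially. \<bar>S n - S a\<bar> \<le> 2 * B / (a + 1)"
    using S_diff_le eventually_sequentially by blast
qed simp

text \<open>Reduces nonvanishing at 1 for a concrete character to one finite computation: a partial
  sum larger than its tail bound.\<close>

lemma L_pos:
  assumes "S a > 2 * B / (a + 1)"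
  shows "L > 0"
  using L_S_le[of a] assms by linarith

lemma sum_ln_over_le: "\<bar>\<Sum>n=1..N. \<chi> n / n * ln n\<bar> \<le> 2 * B + 2"
proof -
  \<comment> \<open>\<open>ln n / n\<close> decreases only beyond \<open>e < 3\<close>, so Abel
    summation starts at 3 and the term at 2 is bounded by hand.\<close>
  have main: "\<bar>\<Sum>n=Suc 2..N. \<chi> n * (ln n / n)\<bar> \<le> 2 * B * (ln (Suc 2) / Suc 2)"
  proof (rule abel_bound)
    fix n :: nat assume n: "n > 2"
    have "1 \<le> ln (real n)"
    proof -
      have "exp 1 \<le> real n" using exp_le n by linarith
      then show ?thesis using n by (simp add: ln_ge_iff)
    qed
    moreover have "n * (ln (real (Suc n)) - ln n) \<le> 1"
      using ln_diff_le[of "real (Suc n)" "real n"] n by (simp add: field_simps)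
    ultimately show "ln (Suc n) / Suc n \<le> ln n / n" using n by (simp add: field_simps)
  qed auto
  have "ln (Suc 2) / Suc 2 \<le> (1::real)" using ln_le_minus_one[of "3::real"] by simp
  then have "2 * B * (ln (Suc 2) / Suc 2) \<le> 2 * B" using mult_left_mono[of "ln (Suc 2) / Suc 2" "1::real" "2 * B"] B_nonneg by simp
  then have main': "\<bar>\<Sum>n=Suc 2..N. \<chi> n / n * ln n\<bar> \<le> 2 * B" using main by simp
  have two: "\<bar>\<chi> 2 / 2 * ln 2\<bar> \<le> 1"
    using abs_le_1[of 2] ln_le_minus_one[of "2::real"] mult_mono[of "\<bar>\<chi> 2\<bar>" 1 "ln 2" "1::real"]
    by (simp add: abs_mult)
  consider "N = 0" | "N = 1" | "N \<ge> 2" by linarith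
  then show ?thesis
  proof cases
    case 3
    have "(\<Sum>n=1..N. \<chi> n / n * ln n) = (\<Sum>n=1..2. \<chi> n / n * ln n) + (\<Sum>n=Suc 2..N. \<chi> n / n * ln n)"
      by (rule sum_split_at[OF 3])
    also have "(\<Sum>n=1..2. \<chi> n / n * ln n) = \<chi> 2 / 2 * ln 2"
      by (simp add: numeral_2_eq_2)
    finally show ?thesis using main' two by linarith
  qed (use B_nonneg in auto)
qed

text \<open>The bounded sum of \<open>\<chi> n * ln n / n\<close> equals the sum of
  \<open>\<chi> d * mangoldt d / d * S (N div d)\<close>. Replacing \<open>S (N div d)\<close> by
  \<open>L\<close> costs at most \<open>2 * B * d / N\<close> in each term, and Chebyshev's bound
  turns the total into \<open>8 * B\<close>.\<close>

lemma L_mangoldt_le: "\<bar>L * (\<Sum>d=1..N. \<chi> d * mangoldt d / d)\<bar> \<le> 10 * B + 2"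
proof (cases "N = 0")
  case False
  have "(\<Sum>n=1..N. \<chi> n / n * ln n) = (\<Sum>d=1..N. mangoldt d * (\<Sum>m=1..N div d. \<chi> (d*m) / real (d * m)))"
    using sum_mult_ln_eq_mangoldt[of "\<lambda>n. \<chi> n / n" N] by simp
  also have "\<dots> = (\<Sum>d=1..N. \<chi> d * mangoldt d / d * S (N div d))"
    by (intro sum.cong refl) (simp add: S_def mult sum_distrib_left mult_ac)
  finally have eq: "L * (\<Sum>d=1..N. \<chi> d * mangoldt d / d) = (\<Sum>n=1..N. \<chi> n / n * ln n)
     + (\<Sum>d=1..N. \<chi> d * mangoldt d / d * (L - S (N div d)))"
    by (simp add: right_diff_distrib sum_subtractf sum_distrib_left diff_divide_distrib mult_ac)
  have "\<bar>\<Sum>d=1..N. \<chi> d * mangoldt d / d * (L - S (N div d))\<bar>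
      \<le> (\<Sum>d=1..N. \<bar>\<chi> d * mangoldt d / d * (L - S (N div d))\<bar>)" by (rule sum_abs)
  also have "\<dots> \<le> (\<Sum>d=1..N. 2 * B / N * mangoldt d)"
  proof (rule sum_mono)
    fix d assume d: "d \<in> {1..N}"
    have "\<bar>L - S (N div d)\<bar> \<le> 2 * B / (real (N div d) + 1)" using L_S_le[of "N div d"] by (simp add: add.commute)
    also have "\<dots> \<le> 2 * B / (N / d)"
      using floor_divide_of_nat_eq[of N d, where 'a=real] d B_nonneg
      by (intro divide_left_mono) (auto intro!: mult_pos_pos, linarith)
    finally have "\<bar>L - S (N div d)\<bar> \<le> 2 * B / N * d" by simp
    moreover have "\<bar>\<chi> d * mangoldt d / d\<bar> \<le> mangoldt d / d"
      using mult_right_mono[OF abs_le_1[of d] mangoldt_nonneg[of d]] d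
      by (simp add: abs_mult divide_right_mono)
    ultimately have "\<bar>\<chi> d * mangoldt d / d * (L - S (N div d))\<bar> \<le> mangoldt d / d * (2 * B / N * d)"
      unfolding abs_mult[of "\<chi> d * mangoldt d / d"] by (intro mult_mono) (auto simp: mangoldt_nonneg)
    then show "\<bar>\<chi> d * mangoldt d / d * (L - S (N div d))\<bar> \<le> 2 * B / N * mangoldt d"
      using d by (simp add: mult_ac)
  qed
  also have "\<dots> = 2 * B / N * (\<Sum>d=1..N. mangoldt d)" by (simp add: sum_distrib_left)
  also have "\<dots> \<le> 2 * B / N * (4 * N)"
    using chebyshev_psi_le[of N] B_nonneg by (intro mult_left_mono) auto
  also have "\<dots> = 8 * B" using False by simp
  finally show ?thesis using sum_ln_over_le[of N] unfolding eq by linarith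
qed (use B_nonneg in simp)

lemma mangoldt_sum_bounded:
  assumes "L > 0"
  obtains C where "\<And>N. \<bar>\<Sum>d=1..N. \<chi> d * mangoldt d / d\<bar> \<le> C"
proof
  fix N show "\<bar>\<Sum>d=1..N. \<chi> d * mangoldt d / d\<bar> \<le> (10 * B + 2) / L"
    using L_mangoldt_le[of N] assms by (simp add: abs_mult pos_le_divide_eq mult.commute)
qed

end

section \<open>The quadratic characters modulo 4, 17 and 68\<close>

lemma periodic_sum_mod:
  fixes f :: "nat \<Rightarrow> 'a::comm_monoid_add"
  assumes per: "\<And>n. f (n + q) = f n" and zero: "(\<Sum>k=1..q. f k) = 0"
  shows "(\<Sum>k=1..n. f k) = (\<Sum>k=1..n mod q. f k)"
proof (induction n rule: less_induct)
  case (less n)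
  show ?case
  proof (cases "n < q \<or> q = 0")
    case False
    then have q: "q \<le> n" "n - q < n" by auto
    have "(\<Sum>k=1..n. f k) = (\<Sum>k=Suc q..n. f k)"
      using sum_split_at[OF q(1), of f] zero by simp
    also have "\<dots> = (\<Sum>k=1..n - q. f (k + q))"
      using sum.shift_bounds_cl_nat_ivl[of f 1 q "n - q"] q by simp
    also have "\<dots> = (\<Sum>k=1..n mod q. f k)"
      using less[OF q(2)] per le_mod_geq[OF q(1)] by simp
    finally show ?thesis .
  qed auto
qed

definition chi4 :: "nat \<Rightarrow> int" where
  "chi4 n = (if n mod 4 = 1 then 1 else if n mod 4 = 3 then - 1 else 0)"

text \<open>The listed classes are the nonzero squares modulo 17, so this is the Legendre
  symbol.\<close>

definition chi17 :: "nat \<Rightarrow> int" where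
  "chi17 n = (if n mod 17 = 0 then 0 else if n mod 17 \<in> {1, 2, 4, 8, 9, 13, 15, 16} then 1 else - 1)"

text \<open>Together with \<open>upt_rec_numeral\<close>, this rule and the next expand ranges into
  explicit lists, so that claims about all residues become finite evaluations.\<close>

lemma upt_from_0_numeral: "[0..<numeral n] = 0 # [1..<numeral n]"
  by (simp add: upt_conv_Cons)

lemma upt_from_1_numeral: "[Suc 0..<numeral n] = (if 1 < (numeral n :: nat) then Suc 0 # [2..<numeral n] else [])"
  by (simp add: upt_rec[of "Suc 0"] numeral_2_eq_2)

lemma chi4_mod [simp]: "chi4 (n mod 4) = chi4 n"
  by (simp add: chi4_def)

lemma chi4_mult: "chi4 (m * n) = chi4 m * chi4 n"
proof -
  have "list_all (\<lambda>a. list_all (\<lambda>b. chi4 (a * b) = chi4 a * chi4 b) [0..<4]) [0..<4]"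
    by (simp add: upt_from_0_numeral upt_from_1_numeral upt_rec_numeral chi4_def del: upt_Suc)
  then have "\<forall>a<4. \<forall>b<4. chi4 (a * b) = chi4 a * chi4 b"
    unfolding list_all_iff by (metis atLeastLessThan_iff le0 set_upt)
  then have "chi4 ((m mod 4) * (n mod 4) mod 4) = chi4 (m mod 4) * chi4 (n mod 4)"
    by (simp only: chi4_mod)
  then show ?thesis by (simp only: mod_mult_eq chi4_mod)
qed

lemma chi17_mod [simp]: "chi17 (n mod 17) = chi17 n"
  by (simp add: chi17_def)

lemma chi17_mult: "chi17 (m * n) = chi17 m * chi17 n"
proof -
  have "list_all (\<lambda>a. list_all (\<lambda>b. chi17 (a * b) = chi17 a * chi17 b) [0..<17]) [0..<17]"
    by (simp add: upt_from_0_numeral upt_from_1_numeral upt_rec_numeral chi17_def del: upt_Suc)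
  then have "\<forall>a<17. \<forall>b<17. chi17 (a * b) = chi17 a * chi17 b"
    unfolding list_all_iff by (metis atLeastLessThan_iff le0 set_upt)
  then have "chi17 ((m mod 17) * (n mod 17) mod 17) = chi17 (m mod 17) * chi17 (n mod 17)"
    by (simp only: chi17_mod)
  then show ?thesis by (simp only: mod_mult_eq chi17_mod)
qed

text \<open>Since a full period sums to zero, \<open>{1..m}\<close> and \<open>{Suc m..q}\<close>
  have opposite sums, and one of them has at most \<open>q / 2\<close> elements.\<close>

lemma periodic_partial_sum_le:
  fixes f :: "nat \<Rightarrow> int"
  assumes per: "\<And>n. f (n + q) = f n" and le1: "\<And>n. \<bar>f n\<bar> \<le> 1" and zero: "(\<Sum>k=1..q. f k) = 0" and "q > 0"
  shows "\<bar>\<Sum>k=1..n. real_of_int (f k)\<bar> \<le> real q / 2"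
proof -
  define m where "m = n mod q"
  have m: "m \<le> q" unfolding m_def using \<open>q > 0\<close> by simp
  have abs_le: "\<bar>sum f A\<bar> \<le> int (card A)" for A
    using order_trans[OF sum_abs sum_bounded_above[of A "\<lambda>k. \<bar>f k\<bar>" 1]] le1 by simp
  have "(\<Sum>k=1..m. f k) = - (\<Sum>k=Suc m..q. f k)"
    using sum_split_at[OF m, of f] zero by simp
  then have "2 * \<bar>\<Sum>k=1..m. f k\<bar> \<le> int q"
    using abs_le[of "{1..m}"] abs_le[of "{Suc m..q}"] m by simp
  moreover have "(\<Sum>k=1..n. f k) = (\<Sum>k=1..m. f k)"
    unfolding m_def by (rule periodic_sum_mod[OF per zero])
  ultimately have "2 * \<bar>\<Sum>k=1..n. f k\<bar> \<le> int q" by simp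
  then have "2 * \<bar>real_of_int (\<Sum>k=1..n. f k)\<bar> \<le> real q" by linarith
  then show ?thesis by simp
qed

lemma sum_from_1_numeral: "(\<Sum>k=1..numeral n. f k) = f (Suc 0) + sum_list (map f [2..<numeral (Num.inc n)])"
proof -
  have inc: "numeral (Num.inc n) = Suc (numeral n)" by (simp add: numeral_inc)
  have "[Suc 0..<Suc (numeral n)] = Suc 0 # [2..<Suc (numeral n)]"
    unfolding numeral_2_eq_2 by (rule upt_conv_Cons) (simp only: Suc_less_eq zero_less_numeral)
  moreover have "(\<Sum>k=1..numeral n. f k) = (\<Sum>k\<leftarrow>[Suc 0..<Suc (numeral n)]. f k)"
    unfolding interv_sum_list_conv_sum_set_nat set_upt atLeastLessThanSuc_atLeastAtMost One_nat_def ..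
  ultimately show ?thesis unfolding inc by simp
qed

interpretation chi4: bounded_character "\<lambda>n. real_of_int (chi4 n)" 2
proof
  have "(\<Sum>k=1..4. chi4 k) = 0" by (simp only: sum_from_1_numeral) (simp add: upt_rec_numeral chi4_def)
  then show "\<bar>\<Sum>k=1..n. real_of_int (chi4 k)\<bar> \<le> 2" for n
    using periodic_partial_sum_le[of chi4 4 n] by (simp add: chi4_def)
qed (simp add: chi4_mult, simp add: chi4_def)

interpretation chi17: bounded_character "\<lambda>n. real_of_int (chi17 n)" "17 / 2"
proof
  have "(\<Sum>k=1..17. chi17 k) = 0" by (simp only: sum_from_1_numeral) (simp add: upt_rec_numeral chi17_def)
  then show "\<bar>\<Sum>k=1..n. real_of_int (chi17 k)\<bar> \<le> 17 / 2" for n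
    using periodic_partial_sum_le[of chi17 17 n] by (simp add: chi17_def)
qed (simp add: chi17_mult, simp add: chi17_def)

interpretation chi68: bounded_character "\<lambda>n. real_of_int (chi4 n * chi17 n)" 34
proof
  let ?f = "\<lambda>n. chi4 n * chi17 n"
  have "(\<Sum>k=1..68. ?f k) = 0"
    by (simp only: sum_from_1_numeral) (simp add: upt_rec_numeral chi4_def chi17_def)
  moreover have "?f (n + 68) = ?f n" for n
  proof -
    have "(n + 68) mod 4 = n mod 4" "(n + 68) mod 17 = n mod 17"
      using mod_mult_self1[of n 17 4] mod_mult_self1[of n 4 17] by simp_all
    then show ?thesis by (simp only: chi4_def chi17_def)
  qed
  moreover have "\<bar>?f n\<bar> \<le> 1" for n by (simp add: chi4_def chi17_def)
  ultimately show "\<bar>\<Sum>k=1..n. real_of_int (?f k)\<bar> \<le> 34" for n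
    using periodic_partial_sum_le[of ?f 68 n] by simp
qed (simp add: chi4_mult chi17_mult, simp add: chi17_def chi4_def)

text \<open>For each of the three characters, the partial sum over one or two full periods already
  exceeds the tail bound.\<close>

lemma L_chi4_pos: "chi4.L > 0"
proof (rule chi4.L_pos[of 8])
  show "2 * 2 / real (8 + 1) < chi4.S 8"
    unfolding chi4.S_def by (simp only: sum_from_1_numeral) (simp add: upt_rec_numeral chi4_def)
qed

lemma L_chi17_pos: "chi17.L > 0"
proof (rule chi17.L_pos[of 34])
  show "2 * (17 / 2) / real (34 + 1) < chi17.S 34"
    unfolding chi17.S_def by (simp only: sum_from_1_numeral) (simp add: upt_rec_numeral chi17_def)
qed

lemma L_chi68_pos: "chi68.L > 0"
proof (rule chi68.L_pos[of 68])
  show "2 * 34 / real (68 + 1) < chi68.S 68"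
    unfolding chi68.S_def by (simp only: sum_from_1_numeral) (simp add: upt_rec_numeral chi4_def chi17_def)
qed

section \<open>Existence of the required primes\<close>

text \<open>Quadratic reciprocity; as 17 is 1 modulo 4, no sign arises.\<close>

lemma QuadRes_17:
  assumes "prime p" "p > 2" "chi17 p = 1"
  shows "QuadRes (int p) 17"
proof -
  have "p mod 17 \<in> {1, 2, 4, 8, 9, 13, 15, 16}"
    using assms(3) by (auto simp: chi17_def split: if_splits)
  \<comment> \<open>Square roots modulo 17 of the eight residues, in the same order.\<close>
  then have "\<exists>y\<in>{1,6,2,5,3,8,7,4}. y\<^sup>2 mod 17 = p mod 17" by auto
  then obtain y :: nat where "y\<^sup>2 mod 17 = p mod 17" by blast
  then have "[y\<^sup>2 = p] (mod 17)" by (simp add: cong_def)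
  then have "[(int y)\<^sup>2 = int p] (mod 17)"
    by (metis cong_int_iff of_nat_numeral of_nat_power)
  moreover have p17: "p mod 17 \<noteq> 0" using assms(3) by (simp add: chi17_def split: if_splits)
  then have "\<not> [int p = 0] (mod 17)"
    by (metis cong_0_iff int_dvd_int_iff mod_0_imp_dvd of_nat_numeral dvd_imp_mod_0)
  ultimately have "Legendre (int p) 17 = 1" by (auto simp: Legendre_def QuadRes_def)
  moreover have "p \<noteq> 17" using p17 by auto
  moreover have "prime (17::nat)" by simp
  ultimately have "Legendre 17 (int p) = 1"
    using Quadratic_Reciprocity[of p 17] assms by simp
  then show ?thesis by (auto simp: Legendre_def split: if_splits)
qed

text \<open>The tail integral of \<open>ln x / x\<^sup>2\<close> from \<open>N\<close> is
  \<open>(ln N + 1) / N\<close>; the additional \<open>1 / N\<close> leaves the room that the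
  induction step needs.\<close>

lemma sum_ln_over_square_le: "N > 0 \<Longrightarrow> (\<Sum>q=1..N. ln (real q) / q\<^sup>2) \<le> 3 - (ln N + 2) / N"
proof (induction N rule: nat_induct_non_zero)
  case (Suc N)
  let ?l = "ln (real (Suc N))"
  have "N * (?l - ln N) \<le> 1"
    using ln_diff_le[of "real (Suc N)" "real N"] Suc.hyps by (simp add: field_simps)
  moreover have "?l - ln N \<le> 1"
  proof -
    have "?l - ln N \<le> 1 / N" using ln_diff_le[of "real (Suc N)" "real N"] Suc.hyps by simp
    also have "\<dots> \<le> 1" using Suc.hyps by simp
    finally show ?thesis .
  qed
  ultimately have "?l \<le> (N + 1) * ln N - N * ?l + 2" by (simp add: algebra_simps)
  then have "?l / (N * (N + 1)) \<le> ((N + 1) * ln N - N * ?l + 2) / (N * (N + 1))"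
    by (intro divide_right_mono) auto
  also have "\<dots> = (ln N + 2) / N - (?l + 2) / (N + 1)" using Suc.hyps by (simp add: field_simps)
  finally have "?l / (N * (N + 1)) \<le> (ln N + 2) / N - (?l + 2) / (N + 1)" .
  moreover have "?l / (real (Suc N))\<^sup>2 \<le> ?l / (N * (N + 1))"
    using Suc.hyps by (intro divide_left_mono) (auto simp: power2_eq_square algebra_simps add_pos_pos)
  ultimately show ?case using Suc.IH by (simp add: add.commute)
qed simp

text \<open>Makes the Mertens sums statements about primes. For each prime \<open>q\<close> the
  powers from the square on form a geometric series of size at most
  \<open>2 * ln q / q\<^sup>2\<close>, and these terms have a bounded sum.\<close>

lemma proper_primepow_sum_le:
  "(\<Sum>d | d \<in> {1..N} \<and> primepow d \<and> \<not> prime d. mangoldt d / real d) \<le> 6"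
proof -
  let ?I = "{q\<in>{2..N}. prime q} \<times> {2..N}"
  let ?f = "\<lambda>(q,k). q ^ k :: nat"
  have "{d. d \<in> {1..N} \<and> primepow d \<and> \<not> prime d} \<subseteq> ?f ` ?I"
  proof
    fix d assume d: "d \<in> {d. d \<in> {1..N} \<and> primepow d \<and> \<not> prime d}"
    then obtain q k where qk: "prime q" "k > 0" "d = q ^ k" by (auto simp: primepow_def)
    have "k \<noteq> 1" using d qk by auto
    then have "k \<ge> 2" using qk by simp
    have q2: "q \<ge> 2" using qk prime_ge_2_nat by blast
    have "q \<le> d" using qk q2 by (simp add: self_le_power)
    moreover have "k \<le> d"
    proof -
      have "k < 2 ^ k" by (rule less_exp)
      also have "\<dots> \<le> d" using qk q2 by (simp add: power_mono)
      finally show ?thesis by simp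
    qed
    moreover have "d \<le> N" using d by simp
    ultimately have "q \<le> N" "k \<le> N" by linarith+
    then have "(q, k) \<in> ?I" using qk q2 \<open>k \<ge> 2\<close> by simp
    then show "d \<in> ?f ` ?I" using qk by force
  qed
  then have "(\<Sum>d | d \<in> {1..N} \<and> primepow d \<and> \<not> prime d. mangoldt d / real d)
      \<le> (\<Sum>d\<in>?f ` ?I. mangoldt d / real d)"
    by (intro sum_mono2) (auto simp: mangoldt_nonneg)
  also have "\<dots> \<le> sum ((\<lambda>d. mangoldt d / real d) \<circ> ?f) ?I"
    by (rule sum_image_le) (auto simp: mangoldt_nonneg)
  also have "\<dots> = (\<Sum>q\<in>{q\<in>{2..N}. prime q}. \<Sum>k=2..N. ln (real q) * (1 / q) ^ k)"
    unfolding sum.cartesian_product by (rule sum.cong) (auto simp: power_divide)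
  also have "\<dots> \<le> (\<Sum>q\<in>{q\<in>{2..N}. prime q}. 2 * (ln (real q) / q\<^sup>2))"
  proof (rule sum_mono)
    fix q assume q: "q \<in> {q\<in>{2..N}. prime q}"
    define x where "x = 1 / real q"
    have x: "0 < x" "x \<le> 1 / 2" using q by (auto simp: x_def field_simps)
    have "(1 - x) * (\<Sum>k=2..N. x ^ k) = x ^ 2 - x ^ Suc N"
      using q by (intro sum_gp_multiplied) auto
    then have "(1 - x) * (\<Sum>k=2..N. x ^ k) \<le> x\<^sup>2" using x by simp
    moreover have "(\<Sum>k=2..N. x ^ k) / 2 \<le> (1 - x) * (\<Sum>k=2..N. x ^ k)"
      using mult_right_mono[of "1/2" "1 - x" "\<Sum>k=2..N. x ^ k"] x sum_nonneg[of "{2..N}" "\<lambda>k. x ^ k"] by simp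
    ultimately have "(\<Sum>k=2..N. x ^ k) \<le> 2 * x\<^sup>2" by linarith
    then have "ln (real q) * (\<Sum>k=2..N. x ^ k) \<le> ln (real q) * (2 * x\<^sup>2)"
      using q by (intro mult_left_mono) auto
    then show "(\<Sum>k=2..N. ln (real q) * (1 / q) ^ k) \<le> 2 * (ln (real q) / q\<^sup>2)"
      by (simp add: x_def sum_distrib_left power_divide mult_ac)
  qed
  also have "\<dots> \<le> (\<Sum>q=1..N. 2 * (ln (real q) / q\<^sup>2))"
    by (rule sum_mono2) auto
  also have "\<dots> \<le> 6"
  proof (cases "N = 0")
    case False
    then have "(ln (real N) + 2) / N \<ge> 0" by simp
    then have "(\<Sum>q=1..N. ln (real q) / q\<^sup>2) \<le> 3"
      using sum_ln_over_square_le[of N] False unfolding of_nat_power by linarith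
    then show ?thesis by (subst sum_distrib_left[symmetric]) linarith
  qed simp
  finally show ?thesis .
qed

text \<open>The weight \<open>g\<close> is 4 on the wanted primes and 0 on all other primes except
  2. Expanding its product gives the four Mertens sums, of which only the principal one is
  unbounded, so \<open>M N\<close> is \<open>ln N\<close> up to a constant. On an interval without
  wanted primes only proper prime powers contribute, which is too little once the ratio of the
  endpoints is large.\<close>

lemma prime_3_mod_4_split_17:
  obtains K where "K > 0"
    and "\<And>y. y > 0 \<Longrightarrow> \<exists>p. prime p \<and> y < p \<and> p \<le> K * y \<and> p mod 4 = 3 \<and> QuadRes (int p) 17"
proof -
  define g where "g d = real_of_int ((1 - chi4 d) * (1 + chi17 d))" for d
  define M where "M N = (\<Sum>d=1..N. g d * (mangoldt d / d))" for N :: nat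
  obtain C1 where C1: "\<And>N. \<bar>\<Sum>d=1..N. real_of_int (chi4 d) * mangoldt d / real d\<bar> \<le> C1"
    using chi4.mangoldt_sum_bounded[OF L_chi4_pos] by blast
  obtain C2 where C2: "\<And>N. \<bar>\<Sum>d=1..N. real_of_int (chi17 d) * mangoldt d / real d\<bar> \<le> C2"
    using chi17.mangoldt_sum_bounded[OF L_chi17_pos] by blast
  obtain C3 where C3: "\<And>N. \<bar>\<Sum>d=1..N. real_of_int (chi4 d * chi17 d) * mangoldt d / real d\<bar> \<le> C3"
    using chi68.mangoldt_sum_bounded[OF L_chi68_pos] by blast
  define C where "C = C1 + C2 + C3 + 4"
  have M: "\<bar>M N - ln N\<bar> \<le> C" if "N > 0" for N
  proof -
    have "M N = (\<Sum>d=1..N. mangoldt d / real d) - (\<Sum>d=1..N. real_of_int (chi4 d) * mangoldt d / real d)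
       + (\<Sum>d=1..N. real_of_int (chi17 d) * mangoldt d / real d)
       - (\<Sum>d=1..N. real_of_int (chi4 d * chi17 d) * mangoldt d / real d)"
      unfolding M_def g_def sum.distrib[symmetric] sum_subtractf[symmetric]
      by (rule sum.cong) (auto simp: algebra_simps diff_divide_distrib add_divide_distrib)
    then show ?thesis
      using mertens_lower[OF that] mertens_upper[OF that] C1[of N] C2[of N] C3[of N]
      unfolding C_def by linarith
  qed
  have g_bounds: "0 \<le> g d" "g d \<le> 4" for d
    by (auto simp: g_def chi4_def chi17_def)
  \<comment> \<open>In the exponent, \<open>2 * C\<close> covers the errors of \<open>M\<close> at
    both ends and 25 exceeds the prime power contribution \<open>4 * 6\<close>. The factor 17 allows
    the argument to start at \<open>17 * y\<close>.\<close>
  define K where "K = 17 * nat \<lceil>exp (2 * C + 25)\<rceil>"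
  have K: "exp (2 * C + 25) \<le> real (nat \<lceil>exp (2 * C + 25)\<rceil>)" by linarith
  have *: "\<exists>p. prime p \<and> y < p \<and> p \<le> nat \<lceil>exp (2 * C + 25)\<rceil> * y \<and> p mod 4 = 3 \<and> QuadRes (int p) 17"
    if y: "y \<ge> 17" for y
  proof (rule ccontr)
    let ?x = "nat \<lceil>exp (2 * C + 25)\<rceil> * y"
    assume none: "\<not> ?thesis"
    have K1: "nat \<lceil>exp (2 * C + 25)\<rceil> \<ge> 1"
      using K exp_gt_zero[of "2 * C + 25"] by (metis One_nat_def Suc_leI gr0I of_nat_0 not_less)
    have "exp (2 * C + 25) * y \<le> ?x" using mult_right_mono[OF K, of y] by simp
    then have "ln (exp (2 * C + 25) * y) \<le> ln ?x"
      using y by (intro ln_mono) auto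
    then have ln: "2 * C + 25 + ln y \<le> ln ?x" using y by (simp add: ln_mult)
    have yx: "y \<le> ?x" using K1 by simp
    have "(\<Sum>d=Suc y..?x. g d * (mangoldt d / d))
       \<le> (\<Sum>d=Suc y..?x. if primepow d \<and> \<not> prime d then 4 * (mangoldt d / d) else 0)"
    proof (rule sum_mono)
      fix d assume d: "d \<in> {Suc y..?x}"
      consider "\<not> primepow d" | "primepow d" "\<not> prime d" | "prime d" by blast
      then show "g d * (mangoldt d / d) \<le> (if primepow d \<and> \<not> prime d then 4 * (mangoldt d / d) else 0)"
      proof cases
        case 1 then show ?thesis by (simp add: mangoldt_def)
      next
        case 2 then show ?thesis
          using mult_right_mono[OF g_bounds(2)[of d], of "mangoldt d / d"] by (simp add: mangoldt_nonneg)
      next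
        case 3
        have "g d = 0"
        proof (rule ccontr)
          assume "g d \<noteq> 0"
          then have g: "chi4 d \<noteq> 1" "chi17 d \<noteq> - 1" by (auto simp: g_def)
          \<comment> \<open>Since \<open>d > y \<ge> 17\<close>, the primes 2 and 17, where a
            character vanishes, are out of range.\<close>
          have "\<not> 2 dvd d" "\<not> 17 dvd d"
            using 3 d y by (auto simp: prime_nat_iff)
          then have "d mod 4 = 1 \<or> d mod 4 = 3" "d mod 17 \<noteq> 0" by (presburger, simp add: dvd_eq_mod_eq_0)
          then have "d mod 4 = 3" "chi17 d = 1" using g by (auto simp: chi4_def chi17_def split: if_splits)
          moreover have "QuadRes (int d) 17" using QuadRes_17[OF 3 _ \<open>chi17 d = 1\<close>] d y by simp
          ultimately show False using none 3 d by auto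
        qed
        then show ?thesis using 3 by simp
      qed
    qed
    also have "\<dots> \<le> (\<Sum>d=1..?x. if primepow d \<and> \<not> prime d then 4 * (mangoldt d / d) else 0)"
      by (rule sum_mono2) (auto simp: mangoldt_nonneg)
    also have "\<dots> = 4 * (\<Sum>d | d \<in> {1..?x} \<and> primepow d \<and> \<not> prime d. mangoldt d / d)"
      unfolding sum_distrib_left by (rule sum.mono_neutral_cong_right) auto
    also have "\<dots> \<le> 24" using proper_primepow_sum_le[of ?x] by simp
    finally have "M ?x - M y \<le> 24"
      unfolding M_def using sum_split_at[OF yx, of "\<lambda>d. g d * (mangoldt d / d)"] by simp
    moreover have "M ?x \<ge> ln ?x - C" "M y \<le> ln y + C"
      using M[of ?x] M[of y] y K1 by (auto simp: abs_le_iff)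
    ultimately show False using ln by linarith
  qed
  show thesis
  proof
    show "K > 0" using K exp_gt_zero[of "2 * C + 25"] unfolding K_def
      by (metis gr0I mult_is_0 numeral_eq_iff of_nat_0 not_less zero_neq_numeral)
    fix y :: nat assume "y > 0"
    then show "\<exists>p. prime p \<and> y < p \<and> p \<le> K * y \<and> p mod 4 = 3 \<and> QuadRes (int p) 17"
      using *[of "17 * y"] unfolding K_def by (auto simp: mult_ac intro: less_trans[of y "17 * y"] elim!: ex_forward)
  qed
qed

section \<open>A Behrend set over \<open>\<int>[\<surd>17]\<close>\<close>

text \<open>Irrationality of the square root of 17: the multiplicity of 17 would be even on the left
  and odd on the right.\<close>

lemma sq_eq_17_sq:
  fixes U V :: int
  assumes "U\<^sup>2 = 17 * V\<^sup>2"
  shows "U = 0 \<and> V = 0"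
proof (rule ccontr)
  assume "\<not> ?thesis"
  then have nz: "U \<noteq> 0" "V \<noteq> 0" using assms by auto
  have p: "prime_elem (17::int)" using prime_elem_nat_iff by simp
  have "multiplicity 17 (U\<^sup>2) = multiplicity 17 (17 * V\<^sup>2)" using assms by simp
  also have "\<dots> = Suc (2 * multiplicity 17 V)"
    using nz p by (simp add: prime_elem_multiplicity_mult_distrib prime_elem_multiplicity_power_distrib multiplicity_self)
  also have "multiplicity 17 (U\<^sup>2) = 2 * multiplicity 17 U"
    using nz p by (simp add: prime_elem_multiplicity_power_distrib)
  finally show False by presburger
qed

lemma sqrt17_independent:
  fixes s t :: int
  assumes "real_of_int s + real_of_int t * sqrt 17 = 0"
  shows "s = 0 \<and> t = 0"
proof (rule sq_eq_17_sq)
  have "real_of_int s = - (real_of_int t * sqrt 17)" using assms by simp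
  then have "(real_of_int s)\<^sup>2 = 17 * (real_of_int t)\<^sup>2" by (simp add: power_mult_distrib)
  then show "s\<^sup>2 = 17 * t\<^sup>2" by (metis of_int_eq_iff of_int_mult of_int_numeral of_int_power)
qed

text \<open>Reduction modulo \<open>b\<close> forces the lowest signed digit to vanish; then divide
  by \<open>b\<close>.\<close>

lemma digit_sum_eq_0:
  fixes u :: "nat \<Rightarrow> int"
  assumes "\<And>j. j < K \<Longrightarrow> \<bar>u j\<bar> < b" "(\<Sum>j<K. u j * b ^ j) = 0" "j < K"
  shows "u j = 0"
  using assms
proof (induction K arbitrary: u j)
  case (Suc K)
  let ?T = "\<Sum>j<K. u (Suc j) * b ^ j"
  have eq: "u 0 + b * ?T = 0"
    using Suc.prems(2) by (simp only: sum.lessThan_Suc_shift) (simp add: sum_distrib_left mult_ac)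
  then have "b dvd u 0" by (metis dvd_0_right dvd_add_left_iff dvd_triv_left)
  then have u0: "u 0 = 0"
    using Suc.prems(1)[of 0] dvd_imp_le_int[of "u 0" b] by fastforce
  moreover have "b > 0" using Suc.prems(1)[of 0] by simp
  ultimately have "?T = 0" using eq by simp
  then have "u (Suc i) = 0" if "i < K" for i
    using Suc.IH[of "\<lambda>j. u (Suc j)" i] Suc.prems(1) that by simp
  then show ?case using u0 Suc.prems(3) by (cases j) auto
qed simp

lemma digit_sum_abs_less:
  fixes u :: "nat \<Rightarrow> int"
  assumes "\<And>j. j < K \<Longrightarrow> \<bar>u j\<bar> < b" "b > 0"
  shows "\<bar>\<Sum>j<K. u j * b ^ j\<bar> < b ^ K"
  using assms(1)
proof (induction K)
  case (Suc K)
  have "\<bar>u K * b ^ K\<bar> \<le> (b - 1) * b ^ K"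
    unfolding abs_mult using Suc.prems[of K] assms(2) by (intro mult_mono) auto
  then have "\<bar>u K * b ^ K\<bar> \<le> b * b ^ K - b ^ K" by (simp add: algebra_simps)
  moreover have "\<bar>\<Sum>j<K. u j * b ^ j\<bar> < b ^ K" using Suc by simp
  ultimately show ?case by simp
qed simp

text \<open>Multiplying \<open>U + \<delta> * V\<close> by its conjugate shows that \<open>p\<close>
  divides the norm \<open>U\<^sup>2 - 17 * V\<^sup>2\<close>. The norm is smaller than
  \<open>p\<close>, hence zero, and then so are \<open>U\<close>, \<open>V\<close> and all their
  digits.\<close>

lemma sqrt17_digits_eq_0:
  fixes u v :: "nat \<Rightarrow> int"
  assumes u: "\<And>j. j < K \<Longrightarrow> \<bar>u j\<bar> < b" and v: "\<And>j. j < K \<Longrightarrow> \<bar>v j\<bar> < b" and b: "b > 0"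
    and p: "17 * b ^ (2 * K) < p" and \<delta>: "[\<delta>\<^sup>2 = 17] (mod p)"
    and dvd: "p dvd (\<Sum>j<K. u j * b ^ j) + \<delta> * (\<Sum>j<K. v j * b ^ j)" and j: "j < K"
  shows "u j = 0 \<and> v j = 0"
proof -
  define U where "U = (\<Sum>j<K. u j * b ^ j)"
  define V where "V = (\<Sum>j<K. v j * b ^ j)"
  have U: "\<bar>U\<bar> < b ^ K" and V: "\<bar>V\<bar> < b ^ K"
    unfolding U_def V_def using digit_sum_abs_less u v b by blast+
  have "p dvd (U + \<delta> * V) * (U - \<delta> * V)" using dvd unfolding U_def V_def by (rule dvd_mult2)
  moreover have "p dvd (\<delta>\<^sup>2 - 17) * V\<^sup>2" using \<delta> by (simp add: cong_iff_dvd_diff)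
  ultimately have "p dvd (U + \<delta> * V) * (U - \<delta> * V) + (\<delta>\<^sup>2 - 17) * V\<^sup>2" by (rule dvd_add)
  also have "\<dots> = U\<^sup>2 - 17 * V\<^sup>2" by (simp add: algebra_simps power2_eq_square)
  finally have dvd': "p dvd U\<^sup>2 - 17 * V\<^sup>2" .
  have "U\<^sup>2 < b ^ (2 * K)" "V\<^sup>2 < b ^ (2 * K)"
    using power_strict_mono[of "\<bar>U\<bar>" "b ^ K" 2] power_strict_mono[of "\<bar>V\<bar>" "b ^ K" 2] U V
    by (simp_all add: power_mult[symmetric] mult.commute)
  moreover have "0 \<le> U\<^sup>2" "0 \<le> V\<^sup>2" by auto
  ultimately have "\<bar>U\<^sup>2 - 17 * V\<^sup>2\<bar> < p" using p by linarith
  then have "U\<^sup>2 - 17 * V\<^sup>2 = 0" using dvd' dvd_imp_le_int[of "U\<^sup>2 - 17 * V\<^sup>2" p] by fastforce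
  then have "U = 0 \<and> V = 0" by (intro sq_eq_17_sq) simp
  then show ?thesis using digit_sum_eq_0[of K u b j, OF u _ j] digit_sum_eq_0[of K v b j, OF v _ j] unfolding U_def V_def by blast
qed

text \<open>A line meets a sphere in at most two points.\<close>

lemma collinear_on_sphere_eq:
  fixes z1 z2 z3 :: "nat \<Rightarrow> real"
  assumes rel: "\<And>j. j \<in> J \<Longrightarrow> a1 * (z1 j - z3 j) + a2 * (z2 j - z3 j) = 0"
    and nz: "a1 \<noteq> 0" "a2 \<noteq> 0" "a1 + a2 \<noteq> 0"
    and sphere: "(\<Sum>j\<in>J. (z1 j)\<^sup>2) = R" "(\<Sum>j\<in>J. (z2 j)\<^sup>2) = R" "(\<Sum>j\<in>J. (z3 j)\<^sup>2) = R"
    and "finite J" "j \<in> J"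
  shows "z1 j = z3 j \<and> z2 j = z3 j"
proof -
  define l where "l = - a1 / a2"
  have l: "l \<noteq> 0" "l \<noteq> 1" using nz by (auto simp: l_def field_simps)
  have e: "z2 j - z3 j = l * (z1 j - z3 j)" if "j \<in> J" for j
    using rel[OF that] nz by (simp add: l_def field_simps)
  \<comment> \<open>With \<open>d = z1 - z3\<close>, \<open>P\<close> is the inner product of
    \<open>z3\<close> and \<open>d\<close>, and \<open>Q\<close> is the squared length of
    \<open>d\<close>. As \<open>z2 = z3 + l * d\<close>, the sphere gives
    \<open>2 * P + Q = 0\<close> and \<open>2 * P + l * Q = 0\<close>.\<close>
  define P where "P = (\<Sum>j\<in>J. z3 j * (z1 j - z3 j))"
  define Q where "Q = (\<Sum>j\<in>J. (z1 j - z3 j)\<^sup>2)"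
  have "(\<Sum>j\<in>J. (z1 j)\<^sup>2) = (\<Sum>j\<in>J. (z3 j)\<^sup>2 + 2 * (z3 j * (z1 j - z3 j)) + (z1 j - z3 j)\<^sup>2)"
    by (rule sum.cong) (auto simp: power2_eq_square algebra_simps)
  then have 1: "2 * P + Q = 0"
    using sphere by (simp add: sum.distrib P_def Q_def sum_distrib_left)
  have "(\<Sum>j\<in>J. (z2 j)\<^sup>2) = (\<Sum>j\<in>J. (z3 j)\<^sup>2 + 2 * (z3 j * (z2 j - z3 j)) + (z2 j - z3 j)\<^sup>2)"
    by (rule sum.cong) (auto simp: power2_eq_square algebra_simps)
  also have "\<dots> = (\<Sum>j\<in>J. (z3 j)\<^sup>2 + 2 * l * (z3 j * (z1 j - z3 j)) + l\<^sup>2 * (z1 j - z3 j)\<^sup>2)"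
    by (rule sum.cong) (auto simp: e power_mult_distrib)
  finally have "2 * l * P + l\<^sup>2 * Q = 0"
    using sphere by (simp add: sum.distrib P_def Q_def sum_distrib_left)
  then have "l * (2 * P + l * Q) = 0" by (simp add: algebra_simps power2_eq_square)
  then have "2 * P + l * Q = 0" using l by simp
  moreover have "(l - 1) * Q = (2 * P + l * Q) - (2 * P + Q)" by (simp add: algebra_simps)
  ultimately have "Q = 0" using 1 l by simp
  then have "z1 j - z3 j = 0"
    using \<open>finite J\<close> \<open>j \<in> J\<close> unfolding Q_def by (subst (asm) sum_nonneg_eq_0_iff) auto
  then show ?thesis using e[OF \<open>j \<in> J\<close>] by simp
qed

text \<open>Here \<open>s + t\<delta>\<close> stands for the image in \<open>\<int>/p\<close> of \<open>s + t\<surd>17\<close>.\<close>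

definition relation_free :: "nat \<Rightarrow> int \<Rightarrow> int \<Rightarrow> int set \<Rightarrow> bool" where
  "relation_free C p \<delta> B \<longleftrightarrow>
     (\<forall>s1 t1 s2 t2. \<forall>x1\<in>B. \<forall>x2\<in>B. \<forall>x3\<in>B.
        \<bar>s1\<bar> \<le> C \<and> \<bar>t1\<bar> \<le> C \<and> \<bar>s2\<bar> \<le> C \<and> \<bar>t2\<bar> \<le> C \<and>
        (s1, t1) \<noteq> (0, 0) \<and> (s2, t2) \<noteq> (0, 0) \<and> (s1 + s2, t1 + t2) \<noteq> (0, 0) \<and>
        p dvd (s1 + t1 * \<delta>) * (x1 - x3) + (s2 + t2 * \<delta>) * (x2 - x3)
        \<longrightarrow> x1 = x3 \<and> x2 = x3)"

text \<open>Behrend's construction: digit vectors over \<int>[\<surd>17] are read in base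
  \<open>b\<close> modulo \<open>p\<close>, and pigeonhole selects those on a most popular sphere. A
  relation modulo \<open>p\<close> holds digit by digit because nothing overflows, so it puts three
  points of the sphere on a line.\<close>

lemma exists_relation_free:
  fixes p \<delta> :: int and C K m :: nat
  assumes C: "C > 0" and m: "m > 0" and p: "17 * int ((36 * C + 1) * m) ^ (2 * K) < p" and \<delta>: "[\<delta>\<^sup>2 = 17] (mod p)"
  obtains B where "B \<subseteq> {0..<p}" "relation_free C p \<delta> B"
    "m ^ (2 * K) \<le> card B * ((18 * K * m\<^sup>2 + 1) * (K * m\<^sup>2 + 1))"
proof -
  \<comment> \<open>Multiplying out a relation gives digits of size at most
    \<open>(1 + 17 + 1 + 17) * C * m\<close>, which stays below this base.\<close>
  define b where "b = int ((36 * C + 1) * m)"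
  have b: "b > 0" using m unfolding b_def of_nat_0_less_iff by simp
  define D where "D = {..<K} \<rightarrow>\<^sub>E ({0..<int m} \<times> {0..<int m})"
  have finD: "finite D" unfolding D_def by (intro finite_PiE) auto
  have cardD: "card D = m ^ (2 * K)"
    unfolding D_def by (simp add: card_PiE power_mult power2_eq_square)
  have digit: "0 \<le> fst (f j)" "fst (f j) < int m" "0 \<le> snd (f j)" "snd (f j) < int m"
    if "f \<in> D" "j < K" for f j
  proof -
    have "f j \<in> {0..<int m} \<times> {0..<int m}" using that unfolding D_def by auto
    then show "0 \<le> fst (f j)" "fst (f j) < int m" "0 \<le> snd (f j)" "snd (f j) < int m"
      by (auto simp: mem_Times_iff)
  qed
  \<comment> \<open>The squared length of the digit vector: the square of
    \<open>s + t\<surd>17\<close> has rational part \<open>s\<^sup>2 + 17 * t\<^sup>2\<close> and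
    \<open>\<surd>17\<close>-part \<open>2 * s * t\<close>.\<close>
  define q where "q f = (\<Sum>j<K. (fst (f j))\<^sup>2 + 17 * (snd (f j))\<^sup>2, \<Sum>j<K. fst (f j) * snd (f j))"
    for f :: "nat \<Rightarrow> int \<times> int"
  define E where "E = {0..int (18 * K * m\<^sup>2)} \<times> {0..int (K * m\<^sup>2)}"
  have cardE: "card E = (18 * K * m\<^sup>2 + 1) * (K * m\<^sup>2 + 1)"
  proof -
    have c: "card {0..int k} = k + 1" for k by simp
    show ?thesis unfolding E_def card_cartesian_product c ..
  qed
  have "q f \<in> E" if f: "f \<in> D" for f
  proof -
    have sq: "(fst (f j))\<^sup>2 \<le> int (m\<^sup>2)" "(snd (f j))\<^sup>2 \<le> int (m\<^sup>2)" "fst (f j) * snd (f j) \<le> int (m\<^sup>2)"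
      "0 \<le> fst (f j) * snd (f j)" if "j < K" for j
      using digit[OF f that] unfolding power2_eq_square of_nat_mult
      by (auto intro!: mult_mono)
    have "(\<Sum>j<K. (fst (f j))\<^sup>2 + 17 * (snd (f j))\<^sup>2) \<le> (\<Sum>j<K. 18 * int (m\<^sup>2))"
    proof (rule sum_mono)
      fix j assume "j \<in> {..<K}"
      then show "(fst (f j))\<^sup>2 + 17 * (snd (f j))\<^sup>2 \<le> 18 * int (m\<^sup>2)"
        using sq(1)[of j] sq(2)[of j] by simp
    qed
    moreover have "(\<Sum>j<K. fst (f j) * snd (f j)) \<le> (\<Sum>j<K. int (m\<^sup>2))"
      using sq by (intro sum_mono) auto
    moreover have "0 \<le> (\<Sum>j<K. (fst (f j))\<^sup>2 + 17 * (snd (f j))\<^sup>2)" by (intro sum_nonneg) auto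
    moreover have "0 \<le> (\<Sum>j<K. fst (f j) * snd (f j))" using sq by (intro sum_nonneg) auto
    ultimately show ?thesis unfolding q_def E_def by simp
  qed
  moreover have "finite E" "E \<noteq> {}" unfolding E_def by auto
  ultimately obtain e where e: "card D \<le> card (q -` {e} \<inter> D) * card E"
    using finD pigeonhole_card[of q D E] by blast
  define F where "F = q -` {e} \<inter> D"
  define elt where "elt f = (\<Sum>j<K. (fst (f j) + \<delta> * snd (f j)) * b ^ j) mod p" for f :: "nat \<Rightarrow> int \<times> int"
  have p0: "p > 0"
  proof -
    have "0 \<le> 17 * int ((36 * C + 1) * m) ^ (2 * K)" by simp
    then show ?thesis using p by linarith
  qed
  have rel: "f = h \<and> g = h"
    if F: "f \<in> F" "g \<in> F" "h \<in> F"
      and C: "\<bar>s1\<bar> \<le> int C" "\<bar>t1\<bar> \<le> int C" "\<bar>s2\<bar> \<le> int C" "\<bar>t2\<bar> \<le> int C"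
      and nz: "(s1, t1) \<noteq> (0, 0)" "(s2, t2) \<noteq> (0, 0)" "(s1 + s2, t1 + t2) \<noteq> (0, 0)"
      and dvd: "p dvd (s1 + t1 * \<delta>) * (elt f - elt h) + (s2 + t2 * \<delta>) * (elt g - elt h)"
    for f g h s1 t1 s2 t2
  proof -
    have D: "f \<in> D" "g \<in> D" "h \<in> D" using F unfolding F_def by auto
    define x1 where "x1 j = fst (f j) - fst (h j)" for j
    define y1 where "y1 j = snd (f j) - snd (h j)" for j
    define x2 where "x2 j = fst (g j) - fst (h j)" for j
    define y2 where "y2 j = snd (g j) - snd (h j)" for j
    define u where "u j = s1 * x1 j + 17 * t1 * y1 j + s2 * x2 j + 17 * t2 * y2 j" for j
    define v where "v j = s1 * y1 j + t1 * x1 j + s2 * y2 j + t2 * x2 j" for j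
    have small: "\<bar>x1 j\<bar> \<le> int m" "\<bar>y1 j\<bar> \<le> int m" "\<bar>x2 j\<bar> \<le> int m" "\<bar>y2 j\<bar> \<le> int m" if "j < K" for j
      unfolding x1_def y1_def x2_def y2_def
      using digit[OF D(1) that] digit[OF D(2) that] digit[OF D(3) that] by linarith+
    have prod: "\<bar>s * x\<bar> \<le> int (C * m)" if "\<bar>s\<bar> \<le> int C" "\<bar>x\<bar> \<le> int m" for s x
      unfolding abs_mult of_nat_mult using that by (intro mult_mono) auto
    have bb: "b = 36 * int (C * m) + int m" unfolding b_def by (simp add: algebra_simps)
    have uv: "\<bar>u j\<bar> < b" "\<bar>v j\<bar> < b" if "j < K" for j
      using prod[OF C(1) small(1)[OF that]] prod[OF C(2) small(2)[OF that]]
        prod[OF C(3) small(3)[OF that]] prod[OF C(4) small(4)[OF that]]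
        prod[OF C(1) small(2)[OF that]] prod[OF C(2) small(1)[OF that]]
        prod[OF C(3) small(4)[OF that]] prod[OF C(4) small(3)[OF that]] m
      unfolding u_def v_def bb mult.assoc by linarith+
    let ?S = "\<lambda>f. \<Sum>j<K. (fst (f j) + \<delta> * snd (f j)) * b ^ j"
    have elt_cong: "[elt f = ?S f] (mod p)" for f by (simp add: elt_def cong_def)
    have "[(s1 + t1 * \<delta>) * (elt f - elt h) + (s2 + t2 * \<delta>) * (elt g - elt h)
        = (s1 + t1 * \<delta>) * (?S f - ?S h) + (s2 + t2 * \<delta>) * (?S g - ?S h)] (mod p)"
      by (intro cong_add cong_mult cong_diff elt_cong cong_refl)
    then have "p dvd (s1 + t1 * \<delta>) * (?S f - ?S h) + (s2 + t2 * \<delta>) * (?S g - ?S h)"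
      using dvd cong_dvd_iff by blast
    also have "\<dots> = (\<Sum>j<K. ((s1 + t1 * \<delta>) * (x1 j + \<delta> * y1 j) + (s2 + t2 * \<delta>) * (x2 j + \<delta> * y2 j)) * b ^ j)"
      unfolding sum_subtractf[symmetric] sum_distrib_left sum.distrib[symmetric]
      by (rule sum.cong) (auto simp: x1_def y1_def x2_def y2_def algebra_simps)
    also have "\<dots> = ((\<Sum>j<K. u j * b ^ j) + \<delta> * (\<Sum>j<K. v j * b ^ j))
        + (\<delta>\<^sup>2 - 17) * (\<Sum>j<K. (t1 * y1 j + t2 * y2 j) * b ^ j)"
      unfolding sum_distrib_left sum.distrib[symmetric]
      by (rule sum.cong) (auto simp: u_def v_def algebra_simps power2_eq_square)
    finally have "p dvd (\<Sum>j<K. u j * b ^ j) + \<delta> * (\<Sum>j<K. v j * b ^ j)"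
      using \<delta> by (simp add: cong_iff_dvd_diff dvd_add_left_iff)
    then have zero: "u j = 0 \<and> v j = 0" if "j < K" for j
      using sqrt17_digits_eq_0[of K u b v p \<delta> j, OF uv b p[folded b_def] \<delta> _ that] by blast
    define z where "z f j = real_of_int (fst (f j)) + real_of_int (snd (f j)) * sqrt 17"
      for f :: "nat \<Rightarrow> int \<times> int" and j
    have sphere: "(\<Sum>j<K. (z f j)\<^sup>2) = real_of_int (fst e) + 2 * real_of_int (snd e) * sqrt 17" if "f \<in> F" for f
    proof -
      have "(\<Sum>j<K. (z f j)\<^sup>2) = (\<Sum>j<K. real_of_int ((fst (f j))\<^sup>2 + 17 * (snd (f j))\<^sup>2)
          + 2 * sqrt 17 * real_of_int (fst (f j) * snd (f j)))"
        by (rule sum.cong) (auto simp: z_def power2_sum power_mult_distrib algebra_simps)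
      also have "\<dots> = real_of_int (fst (q f)) + 2 * sqrt 17 * real_of_int (snd (q f))"
        unfolding q_def fst_conv snd_conv of_int_sum sum_distrib_left sum.distrib[symmetric] ..
      finally show ?thesis using that unfolding F_def by simp
    qed
    have "z f j = z h j \<and> z g j = z h j" if j: "j < K" for j
    proof (rule collinear_on_sphere_eq[where J = "{..<K}"])
      show "(real_of_int s1 + real_of_int t1 * sqrt 17) * (z f j - z h j)
         + (real_of_int s2 + real_of_int t2 * sqrt 17) * (z g j - z h j) = 0" if "j \<in> {..<K}" for j
      proof -
        have "(real_of_int s1 + real_of_int t1 * sqrt 17) * (z f j - z h j)
         + (real_of_int s2 + real_of_int t2 * sqrt 17) * (z g j - z h j)
         = real_of_int (u j) + real_of_int (v j) * sqrt 17
           + (sqrt 17 * sqrt 17 - 17) * real_of_int (t1 * y1 j + t2 * y2 j)"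
          unfolding z_def u_def v_def x1_def x2_def y1_def y2_def
          by (simp only: of_int_add of_int_diff of_int_mult of_int_numeral) (simp only: algebra_simps)
        also have "\<dots> = 0" using zero[of j] that by simp
        finally show ?thesis .
      qed
      show "real_of_int s1 + real_of_int t1 * sqrt 17 \<noteq> 0" "real_of_int s2 + real_of_int t2 * sqrt 17 \<noteq> 0"
        using sqrt17_independent nz by blast+
      show "real_of_int s1 + real_of_int t1 * sqrt 17 + (real_of_int s2 + real_of_int t2 * sqrt 17) \<noteq> 0"
        using sqrt17_independent[of "s1 + s2" "t1 + t2"] nz(3) by (auto simp: algebra_simps)
    qed (use F sphere j in auto)
    then have fgh: "f j = h j \<and> g j = h j" if "j < K" for j
      using sqrt17_independent[of "fst (f j) - fst (h j)" "snd (f j) - snd (h j)"]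
        sqrt17_independent[of "fst (g j) - fst (h j)" "snd (g j) - snd (h j)"] that
      unfolding z_def by (simp add: algebra_simps prod_eq_iff)
    have "f = h" by (rule PiE_ext[OF D(1,3)[unfolded D_def]]) (use fgh in auto)
    moreover have "g = h" by (rule PiE_ext[OF D(2,3)[unfolded D_def]]) (use fgh in auto)
    ultimately show ?thesis ..
  qed
  show thesis
  proof
    show "elt ` F \<subseteq> {0..<p}" using p0 by (auto simp: elt_def)
    show "relation_free C p \<delta> (elt ` F)"
      unfolding relation_free_def
    proof (intro allI ballI impI)
      fix s1 t1 s2 t2 x1 x2 x3
      assume x: "x1 \<in> elt ` F" "x2 \<in> elt ` F" "x3 \<in> elt ` F"
        and *: "\<bar>s1\<bar> \<le> int C \<and> \<bar>t1\<bar> \<le> int C \<and> \<bar>s2\<bar> \<le> int C \<and> \<bar>t2\<bar> \<le> int C \<and>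
          (s1, t1) \<noteq> (0, 0) \<and> (s2, t2) \<noteq> (0, 0) \<and> (s1 + s2, t1 + t2) \<noteq> (0, 0) \<and>
          p dvd (s1 + t1 * \<delta>) * (x1 - x3) + (s2 + t2 * \<delta>) * (x2 - x3)"
      obtain f g h where "x1 = elt f" "x2 = elt g" "x3 = elt h" "f \<in> F" "g \<in> F" "h \<in> F"
        using x by (elim imageE)
      then show "x1 = x3 \<and> x2 = x3" using rel[of f g h s1 t1 s2 t2] * by metis
    qed
    show "m ^ (2 * K) \<le> card (elt ` F) * ((18 * K * m\<^sup>2 + 1) * (K * m\<^sup>2 + 1))"
    proof -
      \<comment> \<open>If \<open>elt f = elt h\<close>, then \<open>f, f, h\<close> satisfy the
        relation with coefficients 1, 1, -2, so they coincide.\<close>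
      have "inj_on elt F"
      proof (rule inj_onI)
        fix f h assume fh: "f \<in> F" "h \<in> F" "elt f = elt h"
        have "1 \<le> int C" using C by linarith
        then show "f = h" by (intro conjunct1[OF rel[OF fh(1,1,2), of 1 0 1 0]]) (auto simp: fh(3))
      qed
      then show ?thesis using e unfolding cardD cardE F_def[symmetric] by (simp only: card_image)
    qed
  qed
qed

lemma eventually_le_powr:
  fixes A a :: real
  assumes "a > 0"
  shows "\<forall>\<^sub>F x in at_top. A \<le> x powr a"
proof (rule eventually_at_top_linorderI)
  fix x :: real assume x: "max 1 A powr (1 / a) \<le> x"
  have "A \<le> (max 1 A powr (1 / a)) powr a" using assms by (simp add: powr_powr)
  also have "\<dots> \<le> x powr a" using x assms by (intro powr_mono2) auto
  finally show "A \<le> x powr a" .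
qed

text \<open>The number \<open>K\<close> of digits is fixed with \<open>2 / K < \<epsilon>\<close>,
  and \<open>m\<close> is of order \<open>p powr (1 / (2 * K))\<close>. Restricting to one sphere
  divides the count by at most a constant times \<open>m ^ 4\<close>, so about
  \<open>p powr (1 - 2 / K)\<close> elements remain.\<close>

lemma exists_large_relation_free:
  fixes \<epsilon> :: real
  assumes C: "C > 0" and \<epsilon>: "\<epsilon> > 0"
  obtains P where "\<And>p \<delta>. p \<ge> P \<Longrightarrow> [\<delta>\<^sup>2 = 17] (mod p) \<Longrightarrow>
    \<exists>B\<subseteq>{0..<p}. relation_free C p \<delta> B \<and> real_of_int p powr (1 - \<epsilon>) \<le> card B"
proof -
  obtain K :: nat where K': "2 / \<epsilon> < K" using reals_Archimedean2 by blast
  have "0 < 2 / \<epsilon>" using \<epsilon> by simp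
  then have K: "K > 0" using K' by (cases K) auto
  have K\<epsilon>: "\<epsilon> - 2 / K > 0" using K' K \<epsilon> by (simp add: field_simps)
  \<comment> \<open>With \<open>m \<le> y / c\<close> the base is at most \<open>y / 17\<close>,
    which keeps \<open>17 * b ^ (2 * K)\<close> below \<open>p = y ^ (2 * K)\<close>.\<close>
  define c where "c = 17 * (36 * real C + 1)"
  have c: "c > 0" by (simp add: c_def)
  \<comment> \<open>The total constant loss: rounding gives only \<open>m \<ge> y / (2 * c)\<close>,
    and there are at most \<open>38 * K\<^sup>2 * m ^ 4\<close> spheres.\<close>
  define A where "A = (2 * c) ^ (2 * K) * (38 * (real K)\<^sup>2)"
  have A: "A > 0" using c K by (simp add: A_def)
  have "\<forall>\<^sub>F x in at_top. A \<le> x powr (\<epsilon> - 2 / K) \<and> 2 * c \<le> x powr (1 / (2 * K)) \<and> x > (0::real)"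
    using K\<epsilon> K by (intro eventually_conj eventually_gt_at_top eventually_le_powr) auto
  then obtain P where P: "\<And>x. x \<ge> P \<Longrightarrow> A \<le> x powr (\<epsilon> - 2 / K) \<and> 2 * c \<le> x powr (1 / (2 * K)) \<and> x > 0"
    unfolding eventually_at_top_linorder by blast
  show thesis
  proof
    fix p \<delta> :: int assume "p \<ge> \<lceil>P\<rceil>" and \<delta>: "[\<delta>\<^sup>2 = 17] (mod p)"
    then have "real_of_int p \<ge> P" by linarith
    then have p: "A \<le> p powr (\<epsilon> - 2 / K)" "2 * c \<le> p powr (1 / (2 * K))" "real_of_int p > 0"
      using P by blast+
    define y where "y = p powr (1 / (2 * K))"
    have y_pow: "y ^ (2 * K) = p" "y ^ 4 = p powr (2 / K)"
      using p(3) K by (simp_all add: y_def powr_realpow[symmetric] powr_powr)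
    define m where "m = nat \<lfloor>y / c\<rfloor>"
    have yc: "y / c \<ge> 2" using p(2) c unfolding y_def by (simp add: field_simps)
    then have m: "m > 0" "real m \<le> y / c" "y / (2 * c) \<le> m" unfolding m_def by linarith+
    have "real ((36 * C + 1) * m) \<le> (36 * real C + 1) * (y / c)"
      using mult_left_mono[OF m(2), of "36 * real C + 1"] by (simp add: algebra_simps)
    also have "\<dots> = y / 17" using c unfolding c_def by (simp add: field_simps)
    finally have "real ((36 * C + 1) * m) ^ (2 * K) \<le> (y / 17) ^ (2 * K)"
      by (rule power_mono) simp
    also have "\<dots> = p / 17 ^ (2 * K)" by (simp add: power_divide y_pow)
    also have "\<dots> \<le> p / 17 ^ 2"
      using p(3) K by (intro divide_left_mono power_increasing) auto
    also have "\<dots> < p / 17" using p(3) by simp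
    finally have "17 * real ((36 * C + 1) * m) ^ (2 * K) < p" by simp
    then have "real_of_int (17 * int ((36 * C + 1) * m) ^ (2 * K)) < real_of_int p" by simp
    then have "17 * int ((36 * C + 1) * m) ^ (2 * K) < p" by (simp only: of_int_less_iff)
    from exists_relation_free[OF C m(1) this \<delta>] obtain B where B: "B \<subseteq> {0..<p}" "relation_free C p \<delta> B"
      "m ^ (2 * K) \<le> card B * ((18 * K * m\<^sup>2 + 1) * (K * m\<^sup>2 + 1))" .
    have m1: "1 \<le> K * m\<^sup>2" using K m(1) by simp
    have "(18 * K * m\<^sup>2 + 1) * (K * m\<^sup>2 + 1) \<le> (19 * (K * m\<^sup>2)) * (2 * (K * m\<^sup>2))"
      using m1 by (intro mult_mono) auto
    also have "\<dots> = 38 * K\<^sup>2 * m ^ 4" by (simp add: power2_eq_square power4_eq_xxxx)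
    finally have "m ^ (2 * K) \<le> card B * (38 * K\<^sup>2 * m ^ 4)"
      using B(3) le_trans mult_le_mono2 by blast
    then have "real (m ^ (2 * K)) \<le> real (card B * (38 * K\<^sup>2 * m ^ 4))" by (simp only: of_nat_le_iff)
    then have "real m ^ (2 * K) \<le> card B * (38 * (real K)\<^sup>2 * real m ^ 4)" by simp
    also have "\<dots> \<le> card B * (38 * (real K)\<^sup>2 * y ^ 4)"
    proof -
      have "y / c \<le> y" using c unfolding y_def c_def by (simp add: field_simps)
      then show ?thesis using m(2) by (intro mult_left_mono power_mono) auto
    qed
    finally have "real m ^ (2 * K) \<le> card B * (38 * (real K)\<^sup>2 * y ^ 4)" .
    moreover have "(y / (2 * c)) ^ (2 * K) \<le> real m ^ (2 * K)"
      using m(3) c by (intro power_mono) (auto simp: y_def)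
    ultimately have "p / (2 * c) ^ (2 * K) \<le> card B * (38 * (real K)\<^sup>2 * p powr (2 / K))"
      by (simp add: power_divide y_pow)
    then have "p \<le> A * card B * p powr (2 / K)"
      using c unfolding A_def by (simp add: field_simps)
    also have "\<dots> \<le> p powr (\<epsilon> - 2 / K) * card B * p powr (2 / K)"
      using p(1) by (intro mult_right_mono) auto
    also have "\<dots> = card B * p powr \<epsilon>"
      using p(3) by (simp add: powr_add[symmetric] mult_ac)
    finally have "p / p powr \<epsilon> \<le> card B" using p(3) by (simp add: field_simps)
    then have "p powr (1 - \<epsilon>) \<le> card B" using p(3) by (simp add: powr_diff)
    then show "\<exists>B\<subseteq>{0..<p}. relation_free C p \<delta> B \<and> real_of_int p powr (1 - \<epsilon>) \<le> card B"
      using B by blast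
  qed
qed

section \<open>Four-term relations\<close>

text \<open>As \<open>(p - 1) / 2\<close> is odd, raising \<open>a\<^sup>2 = - b\<^sup>2\<close> to
  this power would give \<open>1 = - 1\<close> by Fermat's theorem if neither number were divisible
  by \<open>p\<close>.\<close>

lemma dvd_sum_two_squares:
  fixes a b :: int and p :: nat
  assumes p: "prime p" "p mod 4 = 3" and dvd: "int p dvd a\<^sup>2 + b\<^sup>2"
  shows "int p dvd a" "int p dvd b"
proof -
  have key: "int p dvd b" if dvd: "int p dvd a\<^sup>2 + b\<^sup>2" for a b :: int
  proof (rule ccontr)
    assume nb: "\<not> int p dvd b"
    have pp: "prime (int p)" using p by simp
    have na: "\<not> int p dvd a"
    proof
      assume "int p dvd a"
      then have "int p dvd a\<^sup>2" by (simp add: power2_eq_square)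
      then have "int p dvd b\<^sup>2" using dvd by (simp add: dvd_add_right_iff)
      then show False using nb pp prime_dvd_power by blast
    qed
    define k where "k = p div 4"
    have k: "p - 1 = 2 * (2 * k + 1)" unfolding k_def using p(2) by presburger
    have fermat: "[c ^ (p - 1) = 1] (mod int p)" if "\<not> int p dvd c" for c
    proof -
      have "\<not> p dvd nat \<bar>c\<bar>" using that by (simp add: int_dvd_int_iff[symmetric])
      then have "[nat \<bar>c\<bar> ^ (p - 1) = 1] (mod p)" using p(1) by (intro fermat_theorem)
      then have "[int (nat \<bar>c\<bar>) ^ (p - 1) = 1] (mod int p)"
        by (metis cong_int_iff of_nat_1 of_nat_power)
      moreover have "even (p - 1)" unfolding k by simp
      ultimately show ?thesis by (simp only: int_nat_eq abs_ge_zero if_True power_even_abs)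
    qed
    have "[a\<^sup>2 = - b\<^sup>2] (mod int p)" using dvd by (simp add: cong_iff_dvd_diff)
    then have "[(a\<^sup>2) ^ (2 * k + 1) = (- b\<^sup>2) ^ (2 * k + 1)] (mod int p)" by (rule cong_pow)
    moreover have "(a\<^sup>2) ^ (2 * k + 1) = a ^ (p - 1)" "(- b\<^sup>2) ^ (2 * k + 1) = - (b ^ (p - 1))"
      unfolding k power_mult by simp_all
    ultimately have "[a ^ (p - 1) = - (b ^ (p - 1))] (mod int p)" by simp
    moreover have "[- (b ^ (p - 1)) = - 1] (mod int p)" using fermat[OF nb] by (simp add: cong_minus_minus_iff)
    ultimately have "[1 = - 1] (mod int p)" using fermat[OF na] by (meson cong_sym cong_trans)
    then have "int p dvd 2" by (simp add: cong_iff_dvd_diff)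
    then have "int p \<le> 2" by (rule zdvd_imp_le) simp
    moreover have "p \<ge> 3" using p(2) by (metis mod_less_eq_dividend)
    ultimately show False by simp
  qed
  show "int p dvd b" by (rule key[OF dvd])
  show "int p dvd a" by (rule key[of b]) (use dvd in \<open>simp add: add.commute\<close>)
qed

lemma eq_if_dvd_diff:
  fixes x y p :: int
  assumes "p dvd x - y" "x \<in> {0..<p}" "y \<in> {0..<p}"
  shows "x = y"
proof (rule ccontr)
  assume "x \<noteq> y"
  then have "p \<le> \<bar>x - y\<bar>" using assms(1) dvd_imp_le_int[of "x - y" p] by simp
  then show False using assms by auto
qed

lemma not_dvd_if_abs_less:
  fixes a p :: int
  assumes "a \<noteq> 0" "\<bar>a\<bar> < p"
  shows "\<not> p dvd a"
  using assms dvd_imp_le_int[of a p] by auto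

text \<open>\<open>M\<close> bounds the differences of slopes. The three-term relations derived
  below have coefficients up to \<open>4 * M\<^sup>2\<close>, and \<open>large\<close> makes 17 and
  the small nonzero integers that get cancelled units modulo \<open>p\<close>.\<close>

locale arithmetic_set =
  fixes p M :: nat and \<delta> :: int and B :: "int set"
  assumes prime: "prime p" and mod4: "p mod 4 = 3" and large: "4 * M ^ 4 + 17 < p"
    and delta: "[\<delta>\<^sup>2 = 17] (mod int p)"
    and B_subset: "B \<subseteq> {0..<int p}" and free: "relation_free (4 * M\<^sup>2) (int p) \<delta> B"
begin

lemma prime_int: "prime (int p)"
  using prime by simp

lemma relation_freeD:
  assumes "x1 \<in> B" "x2 \<in> B" "x3 \<in> B"
    and "\<bar>s1\<bar> \<le> 4 * int M ^ 2" "\<bar>t1\<bar> \<le> 4 * int M ^ 2" "\<bar>s2\<bar> \<le> 4 * int M ^ 2" "\<bar>t2\<bar> \<le> 4 * int M ^ 2"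
    and "s1 \<noteq> 0 \<or> t1 \<noteq> 0" "s2 \<noteq> 0 \<or> t2 \<noteq> 0" "s1 + s2 \<noteq> 0 \<or> t1 + t2 \<noteq> 0"
    and "int p dvd (s1 + t1 * \<delta>) * (x1 - x3) + (s2 + t2 * \<delta>) * (x2 - x3)"
  shows "x1 = x3" "x2 = x3"
  using free[unfolded relation_free_def, rule_format, of x1 x2 x3 s1 t1 s2 t2] assms by auto

lemma bounds:
  assumes "\<bar>a\<bar> \<le> int M" "a \<noteq> 0"
  shows "\<bar>a\<bar> < int p" "int M \<le> int M ^ 2" "int M ^ 2 \<le> int M ^ 4" "4 * int M ^ 4 + 17 < int p"
proof -
  have M: "int M \<ge> 1" using assms by linarith
  show 1: "int M \<le> int M ^ 2" and 2: "int M ^ 2 \<le> int M ^ 4"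
    using power_increasing[of 1 2 "int M"] power_increasing[of 2 4 "int M"] M by auto
  have "int (4 * M ^ 4 + 17) < int p" using large by (simp only: of_nat_less_iff)
  then show "4 * int M ^ 4 + 17 < int p" by simp
  then show "\<bar>a\<bar> < int p" using assms(1) 1 2 M by linarith
qed

text \<open>Coefficients with sum zero make the relation translation invariant, so \<open>a3\<close>
  can be eliminated.\<close>

lemma three_term:
  assumes "\<bar>a1\<bar> \<le> int M" "\<bar>a2\<bar> \<le> int M" "a1 \<noteq> 0" "a2 \<noteq> 0" "a3 \<noteq> 0" "a1 + a2 + a3 = 0"
    and x: "x1 \<in> B" "x2 \<in> B" "x3 \<in> B" and dvd: "int p dvd a1 * x1 + a2 * x2 + a3 * x3"
  shows "x1 = x3"
proof (rule relation_freeD(1)[OF x, of a1 0 a2 0])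
  have a3: "a3 = - a1 - a2" using assms(6) by simp
  show "int p dvd (a1 + 0 * \<delta>) * (x1 - x3) + (a2 + 0 * \<delta>) * (x2 - x3)"
    using dvd unfolding a3 by (simp add: algebra_simps)
  show "\<bar>a1\<bar> \<le> 4 * int M ^ 2" "\<bar>a2\<bar> \<le> 4 * int M ^ 2"
    using bounds[OF assms(1,3)] assms(1,2) by linarith+
qed (use assms in auto)

text \<open>For cycles with two opposite vertices in one part. Subtracting \<open>x3 + x4\<close>
  times the linear relation from the quadratic one leaves
  \<open>a * (x1 - x2) * (x1 + x2 - x3 - x4)\<close>. If the last factor vanishes, substituting for
  \<open>x3\<close> gives a relation between \<open>x1\<close>, \<open>x2\<close> and
  \<open>x4\<close>.\<close>

lemma four_term_degenerate:
  assumes a: "\<bar>a\<bar> \<le> int M" "a \<noteq> 0" and b: "\<bar>b\<bar> \<le> int M" "b \<noteq> 0" and ab: "a + b \<noteq> 0"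
    and x: "x1 \<in> B" "x2 \<in> B" "x3 \<in> B" "x4 \<in> B"
    and lin: "int p dvd a * (x1 - x2) + b * (x3 - x4)"
    and quad: "int p dvd a * (x1\<^sup>2 - x2\<^sup>2) + b * (x3\<^sup>2 - x4\<^sup>2)"
  shows "x1 = x2 \<or> x1 = x4"
proof (rule disjCI)
  assume "x1 \<noteq> x4"
  note bnd = bounds[OF a]
  have "a * (x1 - x2) * (x1 + x2 - x3 - x4)
     = (a * (x1\<^sup>2 - x2\<^sup>2) + b * (x3\<^sup>2 - x4\<^sup>2)) - (a * (x1 - x2) + b * (x3 - x4)) * (x3 + x4)"
    by (simp add: algebra_simps power2_eq_square)
  then have "int p dvd a * (x1 - x2) * (x1 + x2 - x3 - x4)"
    using lin quad by (metis dvd_diff dvd_mult2)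
  moreover have "\<not> int p dvd a" using not_dvd_if_abs_less[OF a(2) bnd(1)] .
  ultimately consider "int p dvd x1 - x2" | "int p dvd x1 + x2 - x3 - x4"
    using prime_int prime_dvd_mult_iff by blast
  then show "x1 = x2"
  proof cases
    case 1 then show ?thesis using eq_if_dvd_diff x B_subset by blast
  next
    case 2
    have "(a + b) * (x1 - x4) + (b - a) * (x2 - x4)
       = (a * (x1 - x2) + b * (x3 - x4)) + b * (x1 + x2 - x3 - x4)" by (simp add: algebra_simps)
    then have dvd: "int p dvd (a + b) * (x1 - x4) + (b - a) * (x2 - x4)"
      using lin 2 by (metis dvd_add dvd_mult)
    show ?thesis
    proof (cases "a = b")
      case True
      then have "int p dvd (2 * a) * (x1 - x4)" using dvd by simp
      moreover have "\<not> int p dvd 2 * a" using a bnd by (intro not_dvd_if_abs_less, simp, linarith)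
      ultimately have "int p dvd x1 - x4" using prime_int prime_dvd_mult_iff by blast
      then show ?thesis using \<open>x1 \<noteq> x4\<close> eq_if_dvd_diff x B_subset by blast
    next
      case False
      have "x1 = x4"
      proof (rule relation_freeD(1)[OF x(1,2,4), of "a + b" 0 "b - a" 0])
        show "\<bar>a + b\<bar> \<le> 4 * int M ^ 2" "\<bar>b - a\<bar> \<le> 4 * int M ^ 2" using a b bnd by linarith+
      qed (use dvd False a b ab in auto)
      then show ?thesis using \<open>x1 \<noteq> x4\<close> by simp
    qed
  qed
qed

lemma abs_mult_le: "\<bar>a\<bar> \<le> int M \<Longrightarrow> \<bar>b\<bar> \<le> int M \<Longrightarrow> \<bar>a * b\<bar> \<le> int M ^ 2"
  unfolding abs_mult power2_eq_square by (rule mult_mono) auto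

text \<open>
  With \<open>w\<^sub>i = x\<^sub>i - x\<^sub>4\<close>, eliminating \<open>w\<^sub>3\<close> from the linear and the quadratic relation and completing the
  square shows that \<open>(a\<^sub>1 (a\<^sub>1 + a\<^sub>3) w\<^sub>1 + a\<^sub>1 a\<^sub>2 w\<^sub>2)\<^sup>2 = a\<^sub>1 a\<^sub>2 a\<^sub>3 a\<^sub>4 w\<^sub>2\<^sup>2\<close>.  If the discriminant is minus a
  square in \<open>\<int>/p\<close>, only the trivial solution is left; if it is a square in \<open>\<int>[\<surd>17]\<close>, the
  equation splits into two three-term relations over that ring.
\<close>

lemma four_term:
  assumes a: "\<bar>a1\<bar> \<le> int M" "\<bar>a2\<bar> \<le> int M" "\<bar>a3\<bar> \<le> int M" "\<bar>a4\<bar> \<le> int M"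
    and nz: "a1 \<noteq> 0" "a2 \<noteq> 0" "a3 \<noteq> 0" "a4 \<noteq> 0"
    and sum: "a1 + a2 + a3 + a4 = 0" and pairs: "a1 + a2 \<noteq> 0" "a1 + a3 \<noteq> 0" "a1 + a4 \<noteq> 0"
    and disc: "a1 * a2 * a3 * a4 = e * n\<^sup>2" "e \<in> {1, - 1, 17, - 17}"
    and x: "x1 \<in> B" "x2 \<in> B" "x3 \<in> B" "x4 \<in> B"
    and lin: "int p dvd a1 * x1 + a2 * x2 + a3 * x3 + a4 * x4"
    and quad: "int p dvd a1 * x1\<^sup>2 + a2 * x2\<^sup>2 + a3 * x3\<^sup>2 + a4 * x4\<^sup>2"
  shows "x1 = x4"
proof -
  note bnd = bounds[OF a(1) nz(1)]
  have a4: "a4 = - (a1 + a2 + a3)" using sum by simp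
  define w1 w2 w3 where "w1 = x1 - x4" and "w2 = x2 - x4" and "w3 = x3 - x4"
  define l where "l = a1 * w1 + a2 * w2 + a3 * w3"
  define q where "q = a1 * w1\<^sup>2 + a2 * w2\<^sup>2 + a3 * w3\<^sup>2"
  have "l = a1 * x1 + a2 * x2 + a3 * x3 + a4 * x4"
    unfolding l_def w1_def w2_def w3_def a4 by (simp add: algebra_simps)
  then have l: "int p dvd l" using lin by simp
  have "q = (a1 * x1\<^sup>2 + a2 * x2\<^sup>2 + a3 * x3\<^sup>2 + a4 * x4\<^sup>2) - 2 * x4 * l"
    unfolding q_def l_def w1_def w2_def w3_def a4 by (simp add: algebra_simps power2_eq_square)
  then have q: "int p dvd q" using quad l by simp
  define E where "E = a1 * ((a1 + a3) * w1 + a2 * w2)"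
  have "E\<^sup>2 - a1 * a2 * a3 * a4 * w2\<^sup>2 = a1 * (a1 + a3) * (a3 * q + l * (l - 2 * a3 * w3))"
    unfolding E_def q_def l_def a4 by (simp add: algebra_simps power2_eq_square)
  moreover have "int p dvd a1 * (a1 + a3) * (a3 * q + l * (l - 2 * a3 * w3))" using l q by simp
  ultimately have E: "int p dvd E\<^sup>2 - e * (n * w2)\<^sup>2"
    unfolding disc(1) by (simp only: power_mult_distrib mult.assoc)
  have n2: "n\<^sup>2 \<le> (int M ^ 2)\<^sup>2"
  proof -
    have "\<bar>(a1 * a2) * (a3 * a4)\<bar> \<le> int M ^ 2 * int M ^ 2"
      unfolding abs_mult[of "a1 * a2"] using a by (intro mult_mono abs_mult_le) auto
    moreover have "\<bar>e * n\<^sup>2\<bar> = \<bar>e\<bar> * n\<^sup>2" by (simp add: abs_mult)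
    moreover have "1 * n\<^sup>2 \<le> \<bar>e\<bar> * n\<^sup>2" using disc(2) by (intro mult_right_mono) auto
    ultimately show ?thesis using disc(1) by (simp add: mult.assoc power2_eq_square)
  qed
  then have n: "\<bar>n\<bar> \<le> int M ^ 2" using power2_le_iff_abs_le[of "int M ^ 2" n] by simp
  have n0: "n \<noteq> 0" using disc(1) nz by auto
  have pn: "\<not> int p dvd n" using n n0 bnd by (intro not_dvd_if_abs_less) auto
  have p17: "\<not> int p dvd 17"
  proof (rule not_dvd_if_abs_less)
    have "0 \<le> int M ^ 4" by simp
    then show "\<bar>17\<bar> < int p" using bnd(4) by linarith
  qed simp
  have p\<delta>: "\<not> int p dvd \<delta>"
  proof
    assume "int p dvd \<delta>"
    then have "int p dvd \<delta>\<^sup>2" by (simp add: power2_eq_square)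
    then show False using delta p17 cong_dvd_iff by blast
  qed
  have s1: "a1 * (a1 + a3) \<noteq> 0" "\<bar>a1 * (a1 + a3)\<bar> \<le> 2 * int M ^ 2"
  proof -
    show "a1 * (a1 + a3) \<noteq> 0" using nz pairs by simp
    show "\<bar>a1 * (a1 + a3)\<bar> \<le> 2 * int M ^ 2"
      using abs_mult_le[OF a(1,1)] abs_mult_le[OF a(1,3)] unfolding distrib_left by linarith
  qed
  have ps1: "\<not> int p dvd a1 * (a1 + a3)" using s1 bnd by (intro not_dvd_if_abs_less) auto
  have trivial: ?thesis if "int p dvd E" "int p dvd w2"
  proof -
    have "E = a1 * (a1 + a3) * w1 + a1 * a2 * w2" by (simp add: E_def algebra_simps)
    then have "int p dvd a1 * (a1 + a3) * w1" using that by (metis dvd_add_left_iff dvd_mult)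
    then have "int p dvd w1" using ps1 prime_int prime_dvd_mult_iff by blast
    then show ?thesis unfolding w1_def using eq_if_dvd_diff x B_subset by blast
  qed
  \<comment> \<open>A linear factor of the norm equation is a three-term relation;
    \<open>nz1\<close> and \<open>nz2\<close> say that its second coefficient and its coefficient
    sum do not vanish.\<close>
  have split: ?thesis if dvd: "int p dvd E + (s + t * \<delta>) * w2" and s: "\<bar>s\<bar> \<le> int M ^ 2" and t: "\<bar>t\<bar> \<le> int M ^ 2"
    and nz1: "a1 * a2 + s \<noteq> 0 \<or> t \<noteq> 0" and nz2: "a1 * (a1 + a2 + a3) + s \<noteq> 0 \<or> t \<noteq> 0" for s t
  proof (rule relation_freeD(1)[OF x(1,2,4), of "a1 * (a1 + a3)" 0 "a1 * a2 + s" t])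
    show "int p dvd (a1 * (a1 + a3) + 0 * \<delta>) * (x1 - x4) + (a1 * a2 + s + t * \<delta>) * (x2 - x4)"
      using dvd unfolding E_def w1_def w2_def by (simp add: algebra_simps)
    show "a1 * (a1 + a3) + (a1 * a2 + s) \<noteq> 0 \<or> 0 + t \<noteq> 0" using nz2 by (simp add: algebra_simps)
    show "\<bar>a1 * a2 + s\<bar> \<le> 4 * int M ^ 2" using abs_mult_le[OF a(1,2)] s by linarith
  qed (use s1 s t nz1 in auto)
  \<comment> \<open>For a rational square root \<open>s\<close> a vanishing coefficient would mean
    \<open>a1 * a2 = a3 * a4\<close> or \<open>a1 * a4 = a2 * a3\<close>. As the \<open>a\<close>'s
    sum to zero, each makes a sum of two of them vanish.\<close>
  have sq_ne: "a1 * a2 + s \<noteq> 0 \<and> a1 * (a1 + a2 + a3) + s \<noteq> 0" if "s\<^sup>2 = a1 * a2 * a3 * a4" for s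
  proof (intro conjI notI)
    assume "a1 * a2 + s = 0"
    then have "s = - (a1 * a2)" by simp
    then have "(a1 * a2) * (a1 * a2) = (a1 * a2) * (a3 * a4)" using that by (simp add: power2_eq_square algebra_simps)
    then have "a1 * a2 = a3 * a4" using nz by simp
    then have "(a1 + a3) * (a1 + a4) = 0" unfolding a4 by (simp add: algebra_simps)
    then show False using pairs by simp
  next
    assume "a1 * (a1 + a2 + a3) + s = 0"
    then have "s = a1 * a4" unfolding a4 by (simp add: algebra_simps)
    then have "(a1 * a4) * (a1 * a4) = (a1 * a4) * (a2 * a3)" using that by (simp add: power2_eq_square algebra_simps)
    then have "a1 * a4 = a2 * a3" using nz by simp
    then have "(a1 + a2) * (a1 + a3) = 0" unfolding a4 by (simp add: algebra_simps)
    then show False using pairs by simp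
  qed
  have delta_dvd: "int p dvd (\<delta>\<^sup>2 - 17) * z" for z using delta by (simp add: cong_iff_dvd_diff)
  consider "e = 1" | "e = - 1" | "e = 17" | "e = - 17" using disc(2) by auto
  then show ?thesis
  proof cases
    case 1
    have "E\<^sup>2 - e * (n * w2)\<^sup>2 = (E + (- n + 0 * \<delta>) * w2) * (E + (n + 0 * \<delta>) * w2)"
      unfolding 1 by (simp add: algebra_simps power2_eq_square)
    then consider "int p dvd E + (- n + 0 * \<delta>) * w2" | "int p dvd E + (n + 0 * \<delta>) * w2"
      using E prime_int prime_dvd_mult_iff by metis
    then show ?thesis
    proof cases
      case 1
      then show ?thesis by (rule split) (use sq_ne[of "- n"] disc(1) \<open>e = 1\<close> n in auto)
    next
      case 2
      then show ?thesis by (rule split) (use sq_ne[of n] disc(1) \<open>e = 1\<close> n in auto)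
    qed
  next
    case 2
    then have "int p dvd E\<^sup>2 + (n * w2)\<^sup>2" using E by simp
    from dvd_sum_two_squares[OF prime mod4 this] show ?thesis
      using pn prime_int prime_dvd_mult_iff trivial by blast
  next
    case 3
    \<comment> \<open>Here \<open>\<delta>\<close> serves as the square root of 17. The resulting
      relations cannot degenerate, since their \<open>\<delta>\<close>-part is
      \<plusminus>\<open>n\<close>.\<close>
    have "E\<^sup>2 - e * (n * w2)\<^sup>2 + - (\<delta>\<^sup>2 - 17) * (n * w2)\<^sup>2 = (E + (0 + (- n) * \<delta>) * w2) * (E + (0 + n * \<delta>) * w2)"
      unfolding 3 by (simp add: algebra_simps power2_eq_square)
    moreover have "int p dvd - (\<delta>\<^sup>2 - 17) * (n * w2)\<^sup>2"
      using delta_dvd[of "(n * w2)\<^sup>2"] by (simp only: mult_minus_left dvd_minus_iff)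
    ultimately have "int p dvd (E + (0 + (- n) * \<delta>) * w2) * (E + (0 + n * \<delta>) * w2)"
      using E by (metis dvd_add)
    then consider "int p dvd E + (0 + (- n) * \<delta>) * w2" | "int p dvd E + (0 + n * \<delta>) * w2"
      using prime_int prime_dvd_mult_iff by blast
    then show ?thesis
    proof cases
      case 1
      then show ?thesis by (rule split) (use n n0 in auto)
    next
      case 2
      then show ?thesis by (rule split) (use n n0 in auto)
    qed
  next
    case 4
    have "E\<^sup>2 - e * (n * w2)\<^sup>2 + (\<delta>\<^sup>2 - 17) * (n * w2)\<^sup>2 = E\<^sup>2 + (n * \<delta> * w2)\<^sup>2"
      unfolding 4 by (simp add: algebra_simps power2_eq_square)
    then have "int p dvd E\<^sup>2 + (n * \<delta> * w2)\<^sup>2" using E delta_dvd by (metis dvd_add)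
    from dvd_sum_two_squares[OF prime mod4 this] show ?thesis
      using pn p\<delta> prime_int prime_dvd_mult_iff trivial by blast
  qed
qed

end

section \<open>The slopes\<close>

text \<open>Up to squares this is the group generated by -1 and 17, that is, the discriminants that
  \<open>four_term\<close> can treat.\<close>

definition sq17 :: "int \<Rightarrow> bool" where
  "sq17 z \<longleftrightarrow> (\<exists>e\<in>{1, - 1, 17, - 17}. \<exists>n. z = e * n\<^sup>2)"

lemma sq17_mult:
  assumes "sq17 x" "sq17 y"
  shows "sq17 (x * y)"
proof -
  obtain e n where x: "e \<in> {1, - 1, 17, - 17}" "x = e * n\<^sup>2" using assms(1) unfolding sq17_def by blast
  obtain f m where y: "f \<in> {1, - 1, 17, - 17}" "y = f * m\<^sup>2" using assms(2) unfolding sq17_def by blast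
  have xy: "x * y = (e * f) * (n * m)\<^sup>2" unfolding x y by (simp add: power_mult_distrib)
  have "\<exists>d\<in>{1, - 1, 17, - 17}. \<exists>k. e * f = d * k\<^sup>2"
  proof (cases "e \<in> {17, - 17} \<and> f \<in> {17, - 17}")
    case True
    then have "e * f = 1 * 17\<^sup>2 \<or> e * f = (- 1) * 17\<^sup>2" by auto
    then show ?thesis by blast
  next
    case False
    then have "e * f \<in> {1, - 1, 17, - 17}" "e * f = (e * f) * 1\<^sup>2" using x(1) y(1) by auto
    then show ?thesis by blast
  qed
  then obtain d k where d: "d \<in> {1, - 1, 17, - 17}" "e * f = d * k\<^sup>2" by blast
  have "x * y = d * (k * (n * m))\<^sup>2" unfolding xy d(2) by (simp add: power_mult_distrib)
  then show ?thesis unfolding sq17_def using d(1) by blast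
qed

text \<open>After removing the common factor of \<open>H\<close> and \<open>m\<close>, the square of
  the rest of \<open>H\<close> divides 17, which is squarefree.\<close>

lemma sq17_cancel:
  assumes "sq17 (H\<^sup>2 * z)" "H \<noteq> 0"
  shows "sq17 z"
proof -
  obtain e m where e: "e \<in> {1, - 1, 17, - 17}" "H\<^sup>2 * z = e * m\<^sup>2" using assms(1) unfolding sq17_def by blast
  have "H\<^sup>2 dvd 17 * m\<^sup>2"
  proof -
    have "e dvd 17" using e(1) by auto
    then have "e * m\<^sup>2 dvd 17 * m\<^sup>2" by (rule mult_dvd_mono) simp
    then show ?thesis using e(2) by (metis dvd_mult_left)
  qed
  obtain g H' m' where g: "H = g * H'" "m = g * m'" "coprime H' m'" "g \<noteq> 0"
    using gcd_coprime_exists[of H m] assms(2) by (metis gcd_eq_0_iff mult.commute)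
  have "H'\<^sup>2 dvd 17 * m'\<^sup>2"
    using \<open>H\<^sup>2 dvd 17 * m\<^sup>2\<close> g(4) unfolding g(1,2) power_mult_distrib
    by (metis dvd_times_left_cancel_iff mult.left_commute power_eq_0_iff)
  then have "H'\<^sup>2 dvd 17" using g(3) by (simp add: coprime_dvd_mult_left_iff)
  have "H' dvd 17" using \<open>H'\<^sup>2 dvd 17\<close> by (metis dvd_mult_left power2_eq_square)
  moreover have "prime (17::int)" by simp
  ultimately have "\<bar>H'\<bar> = 1 \<or> \<bar>H'\<bar> = 17" using prime_int_iff
    by (metis abs_ge_zero abs_dvd_iff)
  then have "H'\<^sup>2 = 1"
  proof
    assume "\<bar>H'\<bar> = 17"
    then have "H'\<^sup>2 = 17\<^sup>2" by (metis power2_abs)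
    then show ?thesis using \<open>H'\<^sup>2 dvd 17\<close> by simp
  next
    assume "\<bar>H'\<bar> = 1"
    then have "H'\<^sup>2 = 1\<^sup>2" by (metis power2_abs)
    then show ?thesis by simp
  qed
  then have "g\<^sup>2 * z = g\<^sup>2 * (e * m'\<^sup>2)" using e(2) unfolding g(1,2) by (simp add: power_mult_distrib mult_ac)
  then have "z = e * m'\<^sup>2" using g(4) by simp
  then show ?thesis unfolding sq17_def using e(1) by blast
qed

text \<open>
  The condition on the products of consecutive differences is invariant under projective maps.  The slopes
  are a projective image of \<open>0, 256, 400, 2704, 4225, \<infinity>\<close>, a configuration found by computer whose finite
  points have all their differences of the form \<open>m\<^sup>2\<close> or \<open>17m\<^sup>2\<close>; \<open>twist\<close> records the denominators of the map up to
  squares.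
\<close>

definition slopes :: "int set" where
  "slopes = {0, 160, 238, 910, 1105, 1785}"

definition twist :: "int \<Rightarrow> int" where
  "twist a = (if a = 0 then 1 else if a = 160 then 273 else if a = 238 then 195
    else if a = 910 then 3 else if a = 1105 then 42 else 26)"

lemma twist_nonzero: "twist a \<noteq> 0"
  by (simp add: twist_def)

lemma slopes_diff_less:
  assumes "a \<in> slopes" "b \<in> slopes" "a < b"
  shows "sq17 (2730 * twist a * twist b * (b - a))"
proof -
  \<comment> \<open>An entry \<open>(a, b, e, n)\<close> certifies that the twisted difference of
    \<open>a\<close> and \<open>b\<close> is \<open>e * n\<^sup>2\<close>.\<close>
  define T :: "(int \<times> int \<times> int \<times> int) set" where "T =
    {(0, 160, 1, 10920), (0, 238, 17, 2730), (0, 910, 1, 2730), (0, 1105, 17, 2730), (0, 1785,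
     17, 2730), (160, 238, 1, 106470), (160, 910, 1, 40950), (160, 1105, 1, 171990), (160,
     1785, 1, 177450), (238, 910, 1, 32760), (238, 1105, 1, 139230), (238, 1785, 17, 35490),
     (910, 1105, 1, 8190), (910, 1785, 1, 13650), (1105, 1785, 17, 10920)}"
  have table: "\<forall>t\<in>T. case t of (a, b, e, n) \<Rightarrow> (e = 1 \<or> e = 17) \<and> 2730 * twist a * twist b * (b - a) = e * n\<^sup>2"
    unfolding T_def by (simp add: twist_def)
  have "\<forall>a\<in>slopes. \<forall>b\<in>slopes. a < b \<longrightarrow> (\<exists>t\<in>T. fst t = a \<and> fst (snd t) = b)"
    unfolding slopes_def T_def by simp
  then obtain t where "t \<in> T" "fst t = a" "fst (snd t) = b" using assms by blast
  then obtain e n where t: "t = (a, b, e, n)"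
    by (metis prod.collapse)
  have "(e = 1 \<or> e = 17) \<and> 2730 * twist a * twist b * (b - a) = e * n\<^sup>2"
    using bspec[OF table \<open>t \<in> T\<close>] unfolding t prod.case .
  then have "e \<in> {1, - 1, 17, - 17} \<and> (\<exists>k. 2730 * twist a * twist b * (b - a) = e * k\<^sup>2)" by blast
  then show ?thesis unfolding sq17_def Bex_def ..
qed

lemma slopes_diff:
  assumes "a \<in> slopes" "b \<in> slopes" "a \<noteq> b"
  shows "sq17 (2730 * twist a * twist b * (b - a))"
proof (cases "a < b")
  case False
  have "sq17 (- 1)" unfolding sq17_def by (rule bexI[of _ "- 1"], rule exI[of _ 1]) auto
  moreover have "sq17 (2730 * twist b * twist a * (a - b))" using slopes_diff_less assms False by simp
  ultimately have "sq17 (- 1 * (2730 * twist b * twist a * (a - b)))" by (rule sq17_mult)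
  moreover have "- 1 * (2730 * twist b * twist a * (a - b)) = 2730 * twist a * twist b * (b - a)"
    by (simp add: algebra_simps)
  ultimately show ?thesis by (simp only:)
qed (use slopes_diff_less assms in simp)

text \<open>Around a closed cycle every twist occurs twice and 2730 four times, so together they
  form a square that can be cancelled.\<close>

lemma slopes_cycle:
  assumes "a \<in> slopes" "b \<in> slopes" "c \<in> slopes" "d \<in> slopes" "a \<noteq> b" "b \<noteq> c" "c \<noteq> d" "d \<noteq> a"
  shows "sq17 ((b - a) * (c - b) * (d - c) * (a - d))"
proof (rule sq17_cancel)
  let ?D = "\<lambda>a b. 2730 * twist a * twist b * (b - a)"
  have "sq17 (?D a b * ?D b c * (?D c d * ?D d a))"
    using assms by (intro sq17_mult slopes_diff)
  also have "?D a b * ?D b c * (?D c d * ?D d a)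
    = (2730\<^sup>2 * (twist a * twist b * twist c * twist d))\<^sup>2 * ((b - a) * (c - b) * (d - c) * (a - d))"
    by (simp only: power2_eq_square mult_ac)
  finally show "sq17 \<dots>" .
  show "2730\<^sup>2 * (twist a * twist b * twist c * twist d) \<noteq> 0" by (simp add: twist_nonzero)
qed

text \<open>Ensures that opposite differences around a cycle do not cancel, also when
  \<open>a = c\<close> or \<open>b = d\<close>.\<close>

lemma slopes_sidon:
  assumes "a \<in> slopes" "b \<in> slopes" "c \<in> slopes" "d \<in> slopes" "a \<noteq> b" "b \<noteq> c" "c \<noteq> d" "d \<noteq> a"
  shows "a + c \<noteq> b + d"
proof -
  have "\<forall>a\<in>slopes. \<forall>b\<in>slopes. a \<noteq> b \<longrightarrow> (\<forall>d\<in>slopes. a \<noteq> d \<longrightarrow> b + d - a \<in> slopes \<longrightarrow> b + d - a = b \<or> b + d - a = d)"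
    unfolding slopes_def by simp
  then show ?thesis using assms by (metis add_diff_cancel_left')
qed

lemma slopes_abs_diff_le:
  assumes "a \<in> slopes" "b \<in> slopes"
  shows "\<bar>a - b\<bar> \<le> 1785"
  using assms unfolding slopes_def by auto

section \<open>The hypergraph\<close>

text \<open>Permits any convenient vertex set: an injection into \<open>{..<N}\<close> carries the
  hypergraph over, and Berge cycles pull back along it.\<close>

lemma ex_girth_ge:
  assumes H: "uniform_hypergraph r X H" "berge_cycle_free g H" and X: "card X \<le> N"
  shows "card H \<le> ex_girth r N g"
proof -
  have X_fin: "finite X" and H_sub: "\<And>E. E \<in> H \<Longrightarrow> E \<subseteq> X \<and> card E = r"
    using H(1) by (auto simp: uniform_hypergraph_def)
  obtain f where f: "inj_on f X" "f ` X \<subseteq> {..<N}"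
    using card_le_inj[OF X_fin finite_lessThan, of N] X by auto
  define H' where "H' = (`) f ` H"
  have "inj_on ((`) f) H"
    using inj_on_image_Pow[OF f(1)] H_sub by (auto intro: inj_on_subset)
  then have card: "card H' = card H" unfolding H'_def by (rule card_image)
  have "uniform_hypergraph r {..<N} H'"
    unfolding uniform_hypergraph_def H'_def
  proof (intro conjI ballI)
    fix E' assume "E' \<in> (`) f ` H"
    then obtain E where E: "E \<in> H" "E' = f ` E" by blast
    then show "E' \<subseteq> {..<N}" using H_sub[OF E(1)] f(2) by blast
    show "card E' = r" using H_sub[OF E(1)] f(1) unfolding E(2) by (metis card_image inj_on_subset)
  qed simp
  moreover have "berge_cycle_free g H'"
    unfolding berge_cycle_free_def
  proof (intro allI impI notI)
    fix k assume k: "2 \<le> k \<and> k < g" and "\<exists>v e. berge_cycle H' k v e"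
    then obtain v e where cyc: "berge_cycle H' k v e" by blast
    then have "\<forall>i<k. e i \<in> (`) f ` H" unfolding berge_cycle_def H'_def by simp
    then have "\<forall>i<k. \<exists>E\<in>H. e i = f ` E" by (simp add: image_iff)
    then obtain e' where e': "\<And>i. i < k \<Longrightarrow> e' i \<in> H" "\<And>i. i < k \<Longrightarrow> e i = f ` e' i" by metis
    define v' where "v' i = inv_into X f (v i)" for i
    have mem: "v' j \<in> e' i" if i: "i < k" and j: "v j \<in> e i" for i j
    proof -
      obtain u where "u \<in> e' i" "v j = f u" using j unfolding e'(2)[OF i] by blast
      moreover have "u \<in> X" using \<open>u \<in> e' i\<close> H_sub e'(1)[OF i] by blast
      ultimately show ?thesis unfolding v'_def using f(1) by simp
    qed
    have v_img: "v i \<in> f ` X" if "i < k" for i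
    proof -
      have "v i \<in> e i" using cyc that unfolding berge_cycle_def by simp
      then have "v i \<in> f ` e' i" unfolding e'(2)[OF that] .
      then show ?thesis using H_sub[OF e'(1)[OF that]] by blast
    qed
    have "berge_cycle H k v' e'"
      unfolding berge_cycle_def
    proof (intro conjI allI impI)
      have inj: "inj_on v {..<k}" "inj_on e {..<k}" using cyc unfolding berge_cycle_def by blast+
      show "inj_on v' {..<k}"
      proof (rule inj_onI)
        fix i j assume ij: "i \<in> {..<k}" "j \<in> {..<k}" "v' i = v' j"
        then have "v i = v j"
          unfolding v'_def using v_img[of i] v_img[of j] by (intro inv_into_injective[of X f]) auto
        then show "i = j" using inj_onD[OF inj(1)] ij by blast
      qed
      show "inj_on e' {..<k}"
      proof (rule inj_onI)
        fix i j assume ij: "i \<in> {..<k}" "j \<in> {..<k}" "e' i = e' j"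
        then have "e i = e j" using e'(2)[of i] e'(2)[of j] by simp
        then show "i = j" using inj_onD[OF inj(2)] ij by blast
      qed
      fix i assume i: "i < k"
      show "e' i \<in> H" by (rule e'(1)[OF i])
      have "v i \<in> e i" "v (Suc i mod k) \<in> e i" using cyc i unfolding berge_cycle_def by auto
      then show "{v' i, v' (Suc i mod k)} \<subseteq> e' i" using mem[OF i] by simp
    qed (use k in simp)
    then show False using H(2) k unfolding berge_cycle_free_def by blast
  qed
  ultimately have "card H' \<in> {card H |H. uniform_hypergraph r {..<N} H \<and> berge_cycle_free g H}" by blast
  then show ?thesis
    unfolding ex_girth_def card[symmetric] by (intro Max_ge ex_girth_set_finite_nonempty(1))
qed

text \<open>1785 is the largest difference of two slopes.\<close>

locale line_hypergraph = arithmetic_set p 1785 \<delta> B for p \<delta> B +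
  fixes r :: nat and c :: "nat \<Rightarrow> int"
  assumes r: "r \<ge> 2" and inj_c: "inj_on c {..<r}" and c_slopes: "c ` {..<r} \<subseteq> slopes"
begin

definition edge :: "int \<times> int \<times> int \<Rightarrow> (nat \<times> int \<times> int) set" where
  "edge = (\<lambda>(x, y, a). (\<lambda>i. (i, (x + c i * a) mod int p, (y + c i * a\<^sup>2) mod int p)) ` {..<r})"

definition params :: "(int \<times> int \<times> int) set" where
  "params = {0..<int p} \<times> {0..<int p} \<times> B"

lemma p_pos: "int p > 0"
  using large by simp

lemma slope_diff:
  assumes "i < r" "j < r" "i \<noteq> j"
  shows "c i \<noteq> c j" "\<bar>c i - c j\<bar> \<le> int 1785"
proof -
  show "c i \<noteq> c j" using inj_c assms by (auto dest: inj_onD)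
  show "\<bar>c i - c j\<bar> \<le> int 1785" using slopes_abs_diff_le c_slopes assms by fastforce
qed

lemma common_vertex:
  assumes "w \<in> edge (x, y, a)" "w \<in> edge (x', y', a')"
  shows "fst w < r" "int p dvd (x - x') + c (fst w) * (a - a')" "int p dvd (y - y') + c (fst w) * (a\<^sup>2 - a'\<^sup>2)"
proof -
  obtain i where i: "i < r" "w = (i, (x + c i * a) mod int p, (y + c i * a\<^sup>2) mod int p)"
    "w = (i, (x' + c i * a') mod int p, (y' + c i * a'\<^sup>2) mod int p)"
    using assms unfolding edge_def by auto
  then show "fst w < r" by simp
  have "[x + c i * a = x' + c i * a'] (mod int p)" "[y + c i * a\<^sup>2 = y' + c i * a'\<^sup>2] (mod int p)"
    using i by (auto simp: cong_def)
  then show "int p dvd (x - x') + c (fst w) * (a - a')" "int p dvd (y - y') + c (fst w) * (a\<^sup>2 - a'\<^sup>2)"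
    using i(2) by (simp_all add: cong_iff_dvd_diff algebra_simps)
qed

lemma params_eqI:
  assumes "(x, y, a) \<in> params" "(x', y', a') \<in> params" "a = a'"
    and "w \<in> edge (x, y, a)" "w \<in> edge (x', y', a')"
  shows "x = x'" "y = y'"
  using common_vertex[OF assms(4,5)] assms(1-3) eq_if_dvd_diff by (auto simp: params_def)

text \<open>Subtracting the congruences of two common vertices leaves a slope difference, a unit,
  times \<open>a - a'\<close>. This excludes cycles of length 2 and makes \<open>edge\<close>
  injective.\<close>

lemma edges_meet_once:
  assumes "t \<in> params" "t' \<in> params" "w \<in> edge t" "w \<in> edge t'" "w' \<in> edge t" "w' \<in> edge t'" "fst w \<noteq> fst w'"
  shows "t = t'"
proof -
  obtain x y a x' y' a' where t: "t = (x, y, a)" "t' = (x', y', a')" by (metis prod.collapse)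
  note w = common_vertex[OF assms(3,4)[unfolded t]] and w' = common_vertex[OF assms(5,6)[unfolded t]]
  have "((x - x') + c (fst w) * (a - a')) - ((x - x') + c (fst w') * (a - a')) = (c (fst w) - c (fst w')) * (a - a')"
    by (simp add: algebra_simps)
  then have "int p dvd (c (fst w) - c (fst w')) * (a - a')" using w(2) w'(2) by (metis dvd_diff)
  moreover have "\<not> int p dvd c (fst w) - c (fst w')"
    using slope_diff[OF w(1) w'(1) assms(7)] bounds(1) by (intro not_dvd_if_abs_less) auto
  ultimately have "int p dvd a - a'" using prime_int prime_dvd_mult_iff by blast
  then have "a = a'" using assms(1,2) B_subset unfolding t params_def by (intro eq_if_dvd_diff) auto
  then show ?thesis using params_eqI assms(1-4) unfolding t by blast
qed

definition H :: "(nat \<times> int \<times> int) set set" where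
  "H = edge ` params"

lemma same_part:
  assumes "w \<in> edge t" "w' \<in> edge t" "fst w = fst w'"
  shows "w = w'"
  using assms unfolding edge_def by (auto split: prod.splits)

lemma uniform: "uniform_hypergraph r ({..<r} \<times> {0..<int p} \<times> {0..<int p}) H"
  unfolding uniform_hypergraph_def
proof (intro conjI ballI)
  fix E assume "E \<in> H"
  then obtain x y a where E: "E = edge (x, y, a)" unfolding H_def by auto
  show "E \<subseteq> {..<r} \<times> {0..<int p} \<times> {0..<int p}" unfolding E edge_def using p_pos by auto
  have "inj_on (\<lambda>i. (i, (x + c i * a) mod int p, (y + c i * a\<^sup>2) mod int p)) {..<r}" by (auto simp: inj_on_def)
  then show "card E = r" unfolding E edge_def by (simp add: card_image)
qed simp

lemma card_H: "card H = p\<^sup>2 * card B"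
proof -
  have "inj_on edge params"
  proof (rule inj_onI)
    fix t t' assume t: "t \<in> params" "t' \<in> params" "edge t = edge t'"
    have ex: "\<exists>w\<in>edge t. fst w = i" if "i < r" for i
      using that unfolding edge_def by (auto split: prod.splits)
    obtain w w' where "w \<in> edge t" "fst w = 0" "w' \<in> edge t" "fst w' = 1"
      using ex[of 0] ex[of 1] r by auto
    then show "t = t'" using edges_meet_once[OF t(1,2), of w w'] t(3) by simp
  qed
  then show ?thesis
    unfolding H_def params_def by (simp add: card_image card_cartesian_product power2_eq_square mult.assoc)
qed

text \<open>
  Going around a cycle, the vertex shared by two consecutive edges gives one congruence; these
  congruences telescope to a linear and a quadratic relation between the directions \<open>a\<close> of the edges.
\<close>

lemma cycle_free: "berge_cycle_free 5 H"
  unfolding berge_cycle_free_def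
proof (intro allI impI notI)
  fix k assume k: "2 \<le> k \<and> k < 5" and "\<exists>v e. berge_cycle H k v e"
  then obtain v e where cyc: "berge_cycle H k v e" by blast
  have v_inj: "inj_on v {..<k}" and e_inj: "inj_on e {..<k}"
    and cyc': "\<And>t. t < k \<Longrightarrow> e t \<in> H \<and> v t \<in> e t \<and> v (Suc t mod k) \<in> e t"
    using cyc unfolding berge_cycle_def by auto
  have "\<forall>t<k. \<exists>s\<in>params. e t = edge s" using cyc' unfolding H_def image_iff by blast
  then obtain s where s: "\<And>t. t < k \<Longrightarrow> s t \<in> params" "\<And>t. t < k \<Longrightarrow> e t = edge (s t)" by metis
  define x y a where "x t = fst (s t)" and "y t = fst (snd (s t))" and "a t = snd (snd (s t))" for t
  have s_eq: "s t = (x t, y t, a t)" for t by (simp add: x_def y_def a_def)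
  define C where "C t = c (fst (v t))" for t
  define nx where "nx t = Suc t mod k" for t
  have nx: "nx t < k" "nx t \<noteq> t" if "t < k" for t
    using that k unfolding nx_def by (auto simp: mod_Suc)
  have inc: "v t \<in> edge (s t)" "v (nx t) \<in> edge (s t)" if "t < k" for t
    using cyc'[OF that] unfolding s(2)[OF that] nx_def by blast+
  have aB: "a t \<in> B" if "t < k" for t using s(1)[OF that] unfolding s_eq params_def by simp
  have part_lt: "fst (v t) < r" if "t < k" for t
    using inc(1)[OF that] inc(1)[OF that] unfolding s_eq by (rule common_vertex(1))
  have CS: "C t \<in> slopes" if "t < k" for t
    using c_slopes part_lt[OF that] unfolding C_def by auto
  have part_ne: "fst (v t) \<noteq> fst (v (nx t))" if "t < k" for t
  proof
    assume "fst (v t) = fst (v (nx t))"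
    with inc[OF that] have "v t = v (nx t)" by (rule same_part)
    then show False using inj_onD[OF v_inj] nx[OF that] that by fastforce
  qed
  have C_ne: "C t \<noteq> C (nx t)" if "t < k" for t
    unfolding C_def by (rule slope_diff(1)[OF part_lt[OF that] part_lt[OF nx(1)[OF that]] part_ne[OF that]])
  have edge_ne: "s t \<noteq> s (nx t)" if "t < k" for t
  proof
    assume "s t = s (nx t)"
    then have "e t = e (nx t)" using s(2)[OF that] s(2)[OF nx(1)[OF that]] by simp
    then show False using inj_onD[OF e_inj] nx[OF that] that by fastforce
  qed
  have shared: "v (nx t) \<in> edge (x t, y t, a t)" "v (nx t) \<in> edge (x (nx t), y (nx t), a (nx t))" if "t < k" for t
    using inc(2)[OF that] inc(1)[OF nx(1)[OF that]] unfolding s_eq by auto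
  have a_ne: "a t \<noteq> a (nx t)" if "t < k" for t
  proof
    assume "a t = a (nx t)"
    then have "x t = x (nx t)" "y t = y (nx t)"
      using params_eqI[OF _ _ _ shared[OF that]] s(1)[OF that] s(1)[OF nx(1)[OF that]] unfolding s_eq by blast+
    then show False using edge_ne[OF that] \<open>a t = a (nx t)\<close> unfolding s_eq by simp
  qed
  have cong: "int p dvd (x t - x (nx t)) + C (nx t) * (a t - a (nx t))"
    "int p dvd (y t - y (nx t)) + C (nx t) * ((a t)\<^sup>2 - (a (nx t))\<^sup>2)" if "t < k" for t
    using common_vertex(2,3)[OF shared[OF that]] unfolding C_def by auto
  have C_diff: "\<bar>C t - C u\<bar> \<le> int 1785" if "t < k" "u < k" for t u
    using slopes_abs_diff_le CS that by simp
  consider "k = 2" | "k = 3" | "k = 4" using k by linarith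
  then show False
  proof cases
    case 1
    then have nx01: "nx 0 = 1" "nx 1 = 0" by (auto simp: nx_def)
    have "s 0 = s 1"
      using edges_meet_once[of "s 0" "s 1" "v 0" "v 1"] s(1) inc[of 0] inc[of 1] part_ne[of 0] nx01 1 by simp
    then show False using edge_ne[of 0] nx01 1 by simp
  next
    case 2
    then have nx012: "nx 0 = 1" "nx 1 = 2" "nx 2 = 0" by (auto simp: nx_def)
    have lt: "0 < k" "1 < k" "2 < k" using 2 by auto
    note cong' = cong(1)[OF lt(1)] cong(1)[OF lt(2)] cong(1)[OF lt(3)]
    note cong' = cong'[unfolded nx012]
    have "int p dvd (x 0 - x 1 + C 1 * (a 0 - a 1)) + (x 1 - x 2 + C 2 * (a 1 - a 2)) + (x 2 - x 0 + C 0 * (a 2 - a 0))"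
      by (intro dvd_add cong')
    also have "\<dots> = (C 1 - C 0) * a 0 + (C 2 - C 1) * a 1 + (C 0 - C 2) * a 2" by (simp add: algebra_simps)
    finally have lin: "int p dvd (C 1 - C 0) * a 0 + (C 2 - C 1) * a 1 + (C 0 - C 2) * a 2" .
    have ne: "C 0 \<noteq> C 1" "C 1 \<noteq> C 2" "C 2 \<noteq> C 0"
      using C_ne[OF lt(1)] C_ne[OF lt(2)] C_ne[OF lt(3)] unfolding nx012 .
    have "a 0 = a 2"
    proof (rule three_term[OF _ _ _ _ _ _ aB[OF lt(1)] aB[OF lt(2)] aB[OF lt(3)] lin])
      show "\<bar>C 1 - C 0\<bar> \<le> int 1785" "\<bar>C 2 - C 1\<bar> \<le> int 1785" by (intro C_diff lt)+
    qed (use ne in simp_all)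
    then show False using a_ne[OF lt(3)] unfolding nx012 by simp
  next
    case 3
    then have nx0123: "nx 0 = 1" "nx 1 = 2" "nx 2 = 3" "nx 3 = 0" by (auto simp: nx_def)
    have lt: "0 < k" "1 < k" "2 < k" "3 < k" using 3 by auto
    note cong' = cong[OF lt(1)] cong[OF lt(2)] cong[OF lt(3)] cong[OF lt(4)]
    note cong' = cong'[unfolded nx0123]
    have ne: "C 0 \<noteq> C 1" "C 1 \<noteq> C 2" "C 2 \<noteq> C 3" "C 3 \<noteq> C 0"
      using C_ne[OF lt(1)] C_ne[OF lt(2)] C_ne[OF lt(3)] C_ne[OF lt(4)] unfolding nx0123 .
    have ane: "a 0 \<noteq> a 1" "a 1 \<noteq> a 2" "a 2 \<noteq> a 3" "a 3 \<noteq> a 0"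
      using a_ne[OF lt(1)] a_ne[OF lt(2)] a_ne[OF lt(3)] a_ne[OF lt(4)] unfolding nx0123 .
    have "int p dvd (x 0 - x 1 + C 1 * (a 0 - a 1)) + (x 1 - x 2 + C 2 * (a 1 - a 2))
        + (x 2 - x 3 + C 3 * (a 2 - a 3)) + (x 3 - x 0 + C 0 * (a 3 - a 0))"
      by (intro dvd_add cong')
    also have "\<dots> = (C 1 - C 0) * a 0 + (C 2 - C 1) * a 1 + (C 3 - C 2) * a 2 + (C 0 - C 3) * a 3"
      by (simp add: algebra_simps)
    finally have lin: "int p dvd (C 1 - C 0) * a 0 + (C 2 - C 1) * a 1 + (C 3 - C 2) * a 2 + (C 0 - C 3) * a 3" .
    have "int p dvd (y 0 - y 1 + C 1 * ((a 0)\<^sup>2 - (a 1)\<^sup>2)) + (y 1 - y 2 + C 2 * ((a 1)\<^sup>2 - (a 2)\<^sup>2))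
        + (y 2 - y 3 + C 3 * ((a 2)\<^sup>2 - (a 3)\<^sup>2)) + (y 3 - y 0 + C 0 * ((a 3)\<^sup>2 - (a 0)\<^sup>2))"
      by (intro dvd_add cong')
    also have "\<dots> = (C 1 - C 0) * (a 0)\<^sup>2 + (C 2 - C 1) * (a 1)\<^sup>2 + (C 3 - C 2) * (a 2)\<^sup>2 + (C 0 - C 3) * (a 3)\<^sup>2"
      by (simp add: algebra_simps)
    finally have quad: "int p dvd (C 1 - C 0) * (a 0)\<^sup>2 + (C 2 - C 1) * (a 1)\<^sup>2 + (C 3 - C 2) * (a 2)\<^sup>2 + (C 0 - C 3) * (a 3)\<^sup>2" .
    have sidon: "C 0 + C 2 \<noteq> C 1 + C 3"
      using slopes_sidon[OF CS[OF lt(1)] CS[OF lt(2)] CS[OF lt(3)] CS[OF lt(4)] ne] .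
    \<comment> \<open>If opposite slopes agree, the four coefficients pair up as
      \<open>a, - a, b, - b\<close>. Otherwise no two of them that are adjacent cancel, and
      \<open>sidon\<close> covers the opposite ones.\<close>
    consider "C 0 = C 2" | "C 1 = C 3" | "C 0 \<noteq> C 2" "C 1 \<noteq> C 3" by blast
    then show False
    proof cases
      case 1
      have "a 0 = a 1 \<or> a 0 = a 3"
      proof (rule four_term_degenerate[OF _ _ _ _ _ aB[OF lt(1)] aB[OF lt(2)] aB[OF lt(3)] aB[OF lt(4)]])
        show "\<bar>C 1 - C 0\<bar> \<le> int 1785" "\<bar>C 3 - C 2\<bar> \<le> int 1785" by (intro C_diff lt)+
        show "int p dvd (C 1 - C 0) * (a 0 - a 1) + (C 3 - C 2) * (a 2 - a 3)"
          using lin unfolding 1 by (simp add: algebra_simps)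
        show "int p dvd (C 1 - C 0) * ((a 0)\<^sup>2 - (a 1)\<^sup>2) + (C 3 - C 2) * ((a 2)\<^sup>2 - (a 3)\<^sup>2)"
          using quad unfolding 1 by (simp add: algebra_simps)
      qed (use ne sidon 1 in simp_all)
      then show False using ane by simp
    next
      case 2
      have "a 1 = a 2 \<or> a 1 = a 0"
      proof (rule four_term_degenerate[OF _ _ _ _ _ aB[OF lt(2)] aB[OF lt(3)] aB[OF lt(4)] aB[OF lt(1)]])
        show "\<bar>C 2 - C 1\<bar> \<le> int 1785" "\<bar>C 0 - C 3\<bar> \<le> int 1785" by (intro C_diff lt)+
        show "int p dvd (C 2 - C 1) * (a 1 - a 2) + (C 0 - C 3) * (a 3 - a 0)"
          using lin unfolding 2 by (simp add: algebra_simps)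
        show "int p dvd (C 2 - C 1) * ((a 1)\<^sup>2 - (a 2)\<^sup>2) + (C 0 - C 3) * ((a 3)\<^sup>2 - (a 0)\<^sup>2)"
          using quad unfolding 2 by (simp add: algebra_simps)
      qed (use ne sidon 2 in simp_all)
      then show False using ane by simp
    next
      case 3
      obtain e n where disc: "e \<in> {1, - 1, 17, - 17}"
        "(C 1 - C 0) * (C 2 - C 1) * (C 3 - C 2) * (C 0 - C 3) = e * n\<^sup>2"
        using slopes_cycle[OF CS[OF lt(1)] CS[OF lt(2)] CS[OF lt(3)] CS[OF lt(4)] ne] unfolding sq17_def by blast
      have "a 0 = a 3"
      proof (rule four_term[OF _ _ _ _ _ _ _ _ _ _ _ _ disc(2,1) aB[OF lt(1)] aB[OF lt(2)] aB[OF lt(3)] aB[OF lt(4)] lin quad])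
        show "\<bar>C 1 - C 0\<bar> \<le> int 1785" "\<bar>C 2 - C 1\<bar> \<le> int 1785"
          "\<bar>C 3 - C 2\<bar> \<le> int 1785" "\<bar>C 0 - C 3\<bar> \<le> int 1785" by (intro C_diff lt)+
        show "C 1 - C 0 + (C 3 - C 2) \<noteq> 0" using sidon by simp
      qed (use ne 3 in simp_all)
      then show False using ane by simp
    qed
  qed
qed

lemma ex_girth_lower_bound:
  assumes "r * p\<^sup>2 \<le> N"
  shows "p\<^sup>2 * card B \<le> ex_girth r N 5"
proof -
  have "card ({..<r} \<times> {0..<int p} \<times> {0..<int p}) \<le> N"
    using assms by (simp add: power2_eq_square)
  from ex_girth_ge[OF uniform cycle_free this] show ?thesis by (simp only: card_H)
qed

end

text \<open>
  For \<open>p \<approx> \<surd>N\<close> the hypergraph has at least \<open>p\<^sup>2 \<cdot> p\<^sup>1\<^sup>-\<^sup>\<epsilon> = p\<^sup>3\<^sup>-\<^sup>\<epsilon>\<close> edges.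
\<close>

lemma ex_girth_5_eventually_ge:
  fixes r :: nat and \<eta> :: real
  assumes r: "2 \<le> r" "r \<le> 6" and \<eta>: "\<eta> > 0"
  shows "\<forall>\<^sub>F N in sequentially. real N powr (3 / 2 - \<eta>) \<le> real (ex_girth r N 5)"
proof -
  define \<epsilon> where "\<epsilon> = min \<eta> 1"
  have \<epsilon>: "0 < \<epsilon>" "\<epsilon> \<le> \<eta>" "\<epsilon> \<le> 1" using \<eta> by (auto simp: \<epsilon>_def)
  define C :: nat where "C = 4 * 1785\<^sup>2"
  obtain K where K: "K > 0"
    "\<And>y. y > 0 \<Longrightarrow> \<exists>p. prime p \<and> y < p \<and> p \<le> K * y \<and> p mod 4 = 3 \<and> QuadRes (int p) 17"
    using prime_3_mod_4_split_17 by blast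
  obtain P where P: "\<And>p \<delta>. p \<ge> P \<Longrightarrow> [\<delta>\<^sup>2 = 17] (mod p) \<Longrightarrow>
    \<exists>B\<subseteq>{0..<p}. relation_free C p \<delta> B \<and> real_of_int p powr (1 - \<epsilon>) \<le> card B"
    using exists_large_relation_free[of C \<epsilon>] \<epsilon>(1) unfolding C_def by auto
  define c where "c i = [0, 160, 238, 910, 1105, 1785 :: int] ! i" for i
  have c6: "{..<6} = {0, 1, 2, 3, 4, 5 :: nat}" by auto
  have "inj_on c {..<6}" "c ` {..<6} \<subseteq> slopes" unfolding c6 by (simp_all add: c_def slopes_def)
  then have c: "inj_on c {..<r}" "c ` {..<r} \<subseteq> slopes" using r by (auto intro: inj_on_subset)
  \<comment> \<open>With \<open>z\<close> the square root of \<open>N\<close>, the prime will lie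
    between \<open>z / D\<close> and \<open>z / 3\<close>: the factor \<open>K\<close> is the width
    of the prime interval, 3 ensures \<open>r * p\<^sup>2 \<le> N\<close> for
    \<open>r \<le> 6\<close>, and 2 pays for rounding.\<close>
  define D :: real where "D = 6 * real K"
  have D: "D > 0" using K by (simp add: D_def)
  \<comment> \<open>Beyond this point both the Behrend set and the condition \<open>large\<close>
    are available.\<close>
  define P' where "P' = max (real_of_int P) (4 * 1785 ^ 4 + 18)"
  have "\<forall>\<^sub>F x in at_top. max (P' * D) (D powr (3 - \<epsilon>)) \<le> x powr (\<epsilon> / 2) \<and> D \<le> x powr (1 / 2) \<and> 1 \<le> (x::real)"
    using \<epsilon> by (intro eventually_conj eventually_le_powr eventually_ge_at_top) auto
  then have "\<forall>\<^sub>F N in sequentially. max (P' * D) (D powr (3 - \<epsilon>)) \<le> real N powr (\<epsilon> / 2) \<and> D \<le> real N powr (1 / 2) \<and> 1 \<le> real N"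
    by (rule eventually_compose_filterlim[OF _ filterlim_real_sequentially])
  then show ?thesis
  proof (rule eventually_mono)
    fix N :: nat
    assume "max (P' * D) (D powr (3 - \<epsilon>)) \<le> real N powr (\<epsilon> / 2) \<and> D \<le> real N powr (1 / 2) \<and> 1 \<le> real N"
    then have N: "P' * D \<le> real N powr (\<epsilon> / 2)" "D powr (3 - \<epsilon>) \<le> real N powr (\<epsilon> / 2)"
      "D \<le> real N powr (1 / 2)" "1 \<le> real N" by auto
    define z where "z = real N powr (1 / 2)"
    have zz: "z * z = N" using N(4) by (simp add: z_def powr_add[symmetric])
    have "real N powr (\<epsilon> / 2) \<le> z" unfolding z_def using N(4) \<epsilon> by (intro powr_mono) auto
    then have zP: "P' \<le> z / D" using N(1) D by (simp add: pos_le_divide_eq)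
    define w where "w = z / (3 * K)"
    define y where "y = nat \<lfloor>w\<rfloor>"
    have w: "z / D = w / 2" "real K * w = z / 3" using K(1) by (simp_all add: w_def D_def)
    have "1 \<le> z / D" using N(3) D unfolding z_def[symmetric] by simp
    then have "2 \<le> w" using w(1) by linarith
    then have y: "y > 0" "y \<le> w" "w / 2 \<le> y" unfolding y_def by linarith+
    obtain p where p: "prime p" "y < p" "p \<le> K * y" "p mod 4 = 3" "QuadRes (int p) 17"
      using K(2)[OF y(1)] by blast
    obtain \<delta> where \<delta>: "[\<delta>\<^sup>2 = 17] (mod int p)" using p(5) unfolding QuadRes_def by blast
    have zp: "z / D \<le> p" using y(3) p(2) w(1) by linarith
    then have pP: "P' \<le> p" using zP by linarith
    then have "P \<le> int p" unfolding P'_def by linarith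
    from P[OF this \<delta>] obtain B where B: "B \<subseteq> {0..<int p}" "relation_free C (int p) \<delta> B"
      "real p powr (1 - \<epsilon>) \<le> card B" by auto
    have "real (4 * 1785 ^ 4 + 17) < real p" using pP unfolding P'_def by simp
    then have "4 * 1785 ^ 4 + 17 < p" by (simp only: of_nat_less_iff)
    then interpret line_hypergraph p \<delta> B r c
      by (intro line_hypergraph.intro arithmetic_set.intro line_hypergraph_axioms.intro
          p(1) p(4) \<delta> B(1) B(2)[unfolded C_def] r(1) c)
    have "real p \<le> z / 3"
    proof -
      have "real p \<le> real K * real y" using p(3) by (metis of_nat_le_iff of_nat_mult)
      also have "\<dots> \<le> real K * w" using y(2) by (intro mult_left_mono) auto
      finally show ?thesis unfolding w(2) .
    qed
    then have "real p * real p \<le> (z / 3) * (z / 3)" by (intro mult_mono) (auto simp: z_def)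
    then have "9 * (real p * real p) \<le> N" using zz by simp
    moreover have "real r * (real p * real p) \<le> 9 * (real p * real p)" using \<open>r \<le> 6\<close> by (intro mult_right_mono) auto
    ultimately have "real (r * p\<^sup>2) \<le> real N" by (simp add: power2_eq_square)
    then have "r * p\<^sup>2 \<le> N" by (simp only: of_nat_le_iff)
    then have "p\<^sup>2 * card B \<le> ex_girth r N 5" by (rule ex_girth_lower_bound)
    then have edges: "real (p\<^sup>2 * card B) \<le> ex_girth r N 5" by (simp only: of_nat_le_iff)
    have p0: "real p > 0" using p(1) prime_gt_0_nat by simp
    have "real N powr (3 / 2 - \<epsilon>) = real N powr (3 / 2 - \<epsilon> / 2) / real N powr (\<epsilon> / 2)"
      using N(4) by (simp add: powr_diff[symmetric])
    also have "\<dots> \<le> real N powr (3 / 2 - \<epsilon> / 2) / D powr (3 - \<epsilon>)"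
      using N D by (intro divide_left_mono) (auto intro!: mult_pos_pos)
    also have "real N powr (3 / 2 - \<epsilon> / 2) = z powr (3 - \<epsilon>)"
      unfolding z_def powr_powr by (simp add: field_simps)
    also have "z powr (3 - \<epsilon>) / D powr (3 - \<epsilon>) = (z / D) powr (3 - \<epsilon>)"
      using D by (simp add: powr_divide z_def)
    also have "\<dots> \<le> real p powr (3 - \<epsilon>)" using zp D \<epsilon> by (intro powr_mono2) (auto simp: z_def)
    also have "\<dots> = (real p)\<^sup>2 * real p powr (1 - \<epsilon>)"
    proof -
      have "real p powr (2 + (1 - \<epsilon>)) = real p powr 2 * real p powr (1 - \<epsilon>)" by (rule powr_add)
      then show ?thesis using p0 by (simp add: powr_numeral)
    qed
    also have "\<dots> \<le> (real p)\<^sup>2 * card B" using B(3) by (intro mult_left_mono) auto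
    also have "\<dots> \<le> ex_girth r N 5" using edges by simp
    finally have "real N powr (3 / 2 - \<epsilon>) \<le> ex_girth r N 5" .
    moreover have "real N powr (3 / 2 - \<eta>) \<le> real N powr (3 / 2 - \<epsilon>)"
      using N(4) \<epsilon> by (intro powr_mono) auto
    ultimately show "real N powr (3 / 2 - \<eta>) \<le> real (ex_girth r N 5)" by linarith
  qed
qed

theorem theorem1p1:
  fixes r :: nat
  assumes "r \<in> {4, 5, 6}"
  shows "\<exists>\<epsilon> :: nat \<Rightarrow> real. \<epsilon> \<longlonglongrightarrow> 0 \<and>
           (\<forall>\<^sub>F N in sequentially. real (ex_girth r N 5) \<ge> real N powr (3 / 2 - \<epsilon> N))"
proof -
  have ge: "\<forall>\<^sub>F N in sequentially. real N powr (3 / 2 - \<eta>) \<le> real (ex_girth r N 5)" if "\<eta> > 0" for \<eta> :: real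
    using assms that by (intro ex_girth_5_eventually_ge) auto
  \<comment> \<open>The smallest nonnegative loss in the exponent for which the bound holds, once
    \<open>N > 1\<close> and the extremal number is positive; the bounds for all fixed
    \<open>\<eta>\<close> force it to tend to 0.\<close>
  define \<epsilon> :: "nat \<Rightarrow> real" where "\<epsilon> N = max 0 (3 / 2 - ln (ex_girth r N 5) / ln N)" for N
  have pos: "real (ex_girth r N 5) > 0" if "real N powr (3 / 2 - \<eta>) \<le> real (ex_girth r N 5)" "N > 1" for N and \<eta> :: real
  proof -
    have "0 < real N powr (3 / 2 - \<eta>)" using that(2) by simp
    then show ?thesis using that(1) by linarith
  qed
  have "\<epsilon> \<longlonglongrightarrow> 0"
  proof (rule tendstoI)
    fix \<eta> :: real assume \<eta>: "\<eta> > 0"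
    have "\<forall>\<^sub>F N in sequentially. real N powr (3 / 2 - \<eta> / 2) \<le> real (ex_girth r N 5) \<and> N > 1"
      using ge[of "\<eta> / 2"] \<eta> by (intro eventually_conj eventually_gt_at_top) auto
    then show "\<forall>\<^sub>F N in sequentially. dist (\<epsilon> N) 0 < \<eta>"
    proof (rule eventually_mono)
      fix N :: nat assume N: "real N powr (3 / 2 - \<eta> / 2) \<le> real (ex_girth r N 5) \<and> N > 1"
      then have "ln (real N powr (3 / 2 - \<eta> / 2)) \<le> ln (ex_girth r N 5)"
        using pos[of N "\<eta> / 2"] by (intro ln_mono) auto
      then have "(3 / 2 - \<eta> / 2) * ln N \<le> ln (ex_girth r N 5)" using N by (simp add: ln_powr)
      then have "3 / 2 - \<eta> / 2 \<le> ln (ex_girth r N 5) / ln N" using N by (simp add: pos_le_divide_eq)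
      then show "dist (\<epsilon> N) 0 < \<eta>" using \<eta> unfolding \<epsilon>_def dist_real_def by linarith
    qed
  qed
  moreover have "\<forall>\<^sub>F N in sequentially. real (ex_girth r N 5) \<ge> real N powr (3 / 2 - \<epsilon> N)"
  proof -
    have "\<forall>\<^sub>F N in sequentially. real N powr (3 / 2 - 1) \<le> real (ex_girth r N 5) \<and> N > 1"
      using ge[of 1] by (intro eventually_conj eventually_gt_at_top) auto
    then show ?thesis
    proof (rule eventually_mono)
      fix N :: nat assume N: "real N powr (3 / 2 - 1) \<le> real (ex_girth r N 5) \<and> N > 1"
      define l where "l = ln (real (ex_girth r N 5)) / ln N"
      have "real N powr (3 / 2 - \<epsilon> N) \<le> real N powr l"
        using N unfolding \<epsilon>_def l_def by (intro powr_mono) auto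
      also have "\<dots> = real (ex_girth r N 5)"
      proof -
        have "real (ex_girth r N 5) > 0" using pos N by blast
        then show ?thesis using N unfolding powr_def l_def by simp
      qed
      finally show "real N powr (3 / 2 - \<epsilon> N) \<le> real (ex_girth r N 5)" .
    qed
  qed
  ultimately show ?thesis by blast
qed

end
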